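(* Let $\Gamma$ be a countable discrete sofic group acting by homeomorphisms on a compact metrizable space $X$, and let $\Sigma=\{\sigma_i:\Gamma\to\mathrm{Sym}(d_i)\}_{i\ge 1}$ be a sofic approximation of $\Gamma$. Then for every $1\le q\le\infty$, $$D_\Sigma(X,\Gamma)=\inf_{\rho\in\mathcal H(X)}\underline{\mathrm{mdim}}_{\Sigma,q}(X,\rho),$$ where $\mathcal H(X)$ is the collection of Hilbert-cube metrics on $X$ and $D_\Sigma(X,\Gamma)$ is the common value of the sofic $p$-metric mean dimensions $\mathrm{mdim}_{\Sigma,\mathrm M,p}(X,\Gamma)$, $1\le p\le\infty$.
   Context: For $d\in\mathbb N=\{1,2,\dots\}$, $[d]=\{1,\dots,d\}$ and $\mathrm{Sym}(d)$ is the permutation group of $[d]$. A sofic approximation of a countable group $\Gamma$ is a sequence of maps $\Sigma=\{\sigma_i:\Gamma\to\mathrm{Sym}(d_i)\}_{i=1}^\infty$ such that (1) for all $s,t\in\Gamma$, $\lim_i \frac1{d_i}|\{v\in[d_i]:\sigma_i(s)\sigma_i(t)(v)=\sigma_i(st)(v)\}|=1$; (2) for all distinct $s,t\in\Gamma$, $\lim_i\frac1{d_i}|\{v\in[d_i]:\sigma_i(s)(v)=\sigma_i(t)(v)\}|=0$; (3) $\lim_i d_i=+\infty$. $\Gamma$ is sofic if it has a sofic approximation. For a map $\sigma:\Gamma\to\mathrm{Sym}(d)$ write $\sigma_s=\sigma(s)$. For a pseudometric space $(Y,\rho)$ and $\varepsilon>0$, a subset $E\subseteq Y$ is $(\rho,\varepsilon)$-spanning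 if for every $y\in Y$ there is $x\in E$ with $\rho(x,y)<\varepsilon$; $\mathrm S_\varepsilon(Y,\rho)$ is the least cardinality of a $(\rho,\varepsilon)$-spanning subset of $Y$. Conventions: $\mathrm S_\varepsilon(\varnothing,\rho)=0$, $\log 0=-\infty$. For a continuous pseudometric $\rho$ on $X$ and maps $\varphi,\psi:[d]\to X$, put $\rho_p(\varphi,\psi)=\left(\frac1d\sum_{v=1}^d\rho(\varphi(v),\psi(v))^p\right)^{1/p}$ for $1\le p<\infty$ and $\rho_\infty(\varphi,\psi)=\max_{1\le v\le d}\rho(\varphi(v),\psi(v))$. For nonempty finite $F\subseteq\Gamma$, $\delta>0$ and $\sigma:\Gamma\to\mathrm{Sym}(d)$, let $\mathrm{Map}(\rho,F,\delta,\sigma)=\{\varphi:[d]\to X:\ \rho_2(\varphi\circ\sigma_s,s\varphi)<\delta\text{ for every }s\in F\}$, where $(s\varphi)(v)=s\varphi(v)$. A continuous pseudometric $\rho$ on $X$ is dynamically generating if for every distinct $x,y\in X$ there is $s\in\Gamma$ with $\rho(sx,sy)>0$. A compatible metric on $X$ is a metric inducing the topology of $X$; every compatible metric is dynamically generating. For $\rho$ a dynamically generating continuous pseudometric, $1\le p\le\infty$ and $\varepsilon>0$, define $$h_{\Sigma,p}(\varepsilon,\rho)=\inf_{F}\inf_{\delta>0}\limsup_{i\to\infty}\frac1{d_i}\log\mathrm S_\varepsilon\bigl(\mathrm{Map}(\rho,F,\delta,\sigma_i),\rho_p\bigr),$$ with $F$ ranging over nonempty finite subsets of $\Gamma$ (the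 value is $-\infty$ if for some $F,\delta$ the sets $\mathrm{Map}(\rho,F,\delta,\sigma_i)$ are empty for all sufficiently large $i$). Define $$\underline{\mathrm{mdim}}_{\Sigma,p}(X,\rho)=\liminf_{\varepsilon\downarrow0}\frac{h_{\Sigma,p}(\varepsilon,\rho)}{\log(1/\varepsilon)},\qquad \mathrm{mdim}_{\Sigma,\mathrm M,p}(X,\Gamma)=\inf_\rho\underline{\mathrm{mdim}}_{\Sigma,p}(X,\rho),$$ the infimum being over all dynamically generating continuous pseudometrics $\rho$ on $X$. The values $\mathrm{mdim}_{\Sigma,\mathrm M,p}(X,\Gamma)$ for $1\le p\le\infty$ all coincide (a theorem of the same paper), and $D_\Sigma(X,\Gamma)\in\{-\infty\}\cup[0,+\infty]$ denotes this common value; in particular $D_\Sigma(X,\Gamma)=\mathrm{mdim}_{\Sigma,\mathrm M,\infty}(X,\Gamma)$. $\mathcal H(X)$ is the collection of metrics on $X$ of the form $\rho_{\mathbf f}(x,y)=\sum_{n=1}^\infty2^{-n}|f_n(x)-f_n(y)|$, where $f_n\in C(X,[0,1])$ and the family $\mathbf f=(f_n)_{n\ge1}$ separates points of $X$. Every member of $\mathcal H(X)$ is a compatible metric. *)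

theory Defs
  imports "HOL-Analysis.Analysis" "HOL-Algebra.Group_Action" "HOL-Algebra.Sym_Groups"
begin

text \<open>
  A sequence of maps \<open>\<sigma> i : \<Gamma> \<rightarrow> Sym (d i)\<close> is a pair of families \<open>d\<close>, \<open>\<sigma>\<close>; sequences are
  indexed from 0. Elements of \<open>Sym(n)\<close> are permutations of \<open>nat\<close> that fix everything
  outside \<open>{1..n}\<close>.
\<close>

definition sofic_approximation ::
    "('g, 'b) monoid_scheme \<Rightarrow> (nat \<Rightarrow> nat) \<Rightarrow> (nat \<Rightarrow> 'g \<Rightarrow> nat \<Rightarrow> nat) \<Rightarrow> bool" where
  "sofic_approximation G d \<sigma> \<longleftrightarrow>
     (\<forall>i. 1 \<le> d i) \<and>
     (\<forall>i. \<sigma> i \<in> carrier G \<rightarrow> carrier (sym_group (d i))) \<and>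
     (\<forall>s\<in>carrier G. \<forall>t\<in>carrier G.
        (\<lambda>i. real (card {v \<in> {1..d i}. \<sigma> i s (\<sigma> i t v) = \<sigma> i (s \<otimes>\<^bsub>G\<^esub> t) v}) / real (d i))
          \<longlonglongrightarrow> 1) \<and>
     (\<forall>s\<in>carrier G. \<forall>t\<in>carrier G. s \<noteq> t \<longrightarrow>
        (\<lambda>i. real (card {v \<in> {1..d i}. \<sigma> i s v = \<sigma> i t v}) / real (d i)) \<longlonglongrightarrow> 0) \<and>
     filterlim d at_top sequentially"

definition sofic_group :: "('g, 'b) monoid_scheme \<Rightarrow> bool" where
  "sofic_group G \<longleftrightarrow>
     group G \<and> countable (carrier G) \<and> (\<exists>d \<sigma>. sofic_approximation G d \<sigma>)"

text \<open>Pseudometrics are functions on the whole type of which only the values on the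
  underlying set matter.\<close>

definition pseudometric_on :: "'a set \<Rightarrow> ('a \<Rightarrow> 'a \<Rightarrow> real) \<Rightarrow> bool" where
  "pseudometric_on M \<rho> \<longleftrightarrow>
     (\<forall>x\<in>M. \<forall>y\<in>M. 0 \<le> \<rho> x y) \<and>
     (\<forall>x\<in>M. \<rho> x x = 0) \<and>
     (\<forall>x\<in>M. \<forall>y\<in>M. \<rho> x y = \<rho> y x) \<and>
     (\<forall>x\<in>M. \<forall>y\<in>M. \<forall>z\<in>M. \<rho> x z \<le> \<rho> x y + \<rho> y z)"

definition continuous_pseudometric :: "'a topology \<Rightarrow> ('a \<Rightarrow> 'a \<Rightarrow> real) \<Rightarrow> bool" where
  "continuous_pseudometric X \<rho> \<longleftrightarrow>
     pseudometric_on (topspace X) \<rho> \<and>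
     continuous_map (prod_topology X X) euclideanreal (\<lambda>(x, y). \<rho> x y)"

definition dynamically_generating ::
    "('g, 'b) monoid_scheme \<Rightarrow> 'a topology \<Rightarrow> ('g \<Rightarrow> 'a \<Rightarrow> 'a) \<Rightarrow> ('a \<Rightarrow> 'a \<Rightarrow> real) \<Rightarrow> bool" where
  "dynamically_generating G X act \<rho> \<longleftrightarrow>
     (\<forall>x\<in>topspace X. \<forall>y\<in>topspace X. x \<noteq> y \<longrightarrow>
        (\<exists>s\<in>carrier G. 0 < \<rho> (act s x) (act s y)))"

definition spanning :: "'a set \<Rightarrow> ('a \<Rightarrow> 'a \<Rightarrow> real) \<Rightarrow> real \<Rightarrow> 'a set \<Rightarrow> bool" where
  "spanning Y \<rho> \<epsilon> E \<longleftrightarrow> E \<subseteq> Y \<and> (\<forall>y\<in>Y. \<exists>x\<in>E. \<rho> x y < \<epsilon>)"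

text \<open>The value is \<open>\<infinity>\<close> when there is no finite spanning set.\<close>

definition spanning_number :: "'a set \<Rightarrow> ('a \<Rightarrow> 'a \<Rightarrow> real) \<Rightarrow> real \<Rightarrow> enat" where
  "spanning_number Y \<rho> \<epsilon> = Inf {enat (card E) |E. finite E \<and> spanning Y \<rho> \<epsilon> E}"

definition log_enat :: "enat \<Rightarrow> ereal" where
  "log_enat n = (case n of enat k \<Rightarrow> if k = 0 then -\<infinity> else ereal (ln (real k)) | \<infinity> \<Rightarrow> \<infinity>)"

text \<open>The exponent \<open>p\<close> ranges over \<open>[1, \<infinity>]\<close>.\<close>

definition lp_dist ::
    "ereal \<Rightarrow> nat \<Rightarrow> ('a \<Rightarrow> 'a \<Rightarrow> real) \<Rightarrow> (nat \<Rightarrow> 'a) \<Rightarrow> (nat \<Rightarrow> 'a) \<Rightarrow> real" where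
  "lp_dist p d \<rho> \<phi> \<psi> =
     (if p = \<infinity> then Max ((\<lambda>v. \<rho> (\<phi> v) (\<psi> v)) ` {1..d})
      else (1 / real d * (\<Sum>v=1..d. \<rho> (\<phi> v) (\<psi> v) powr real_of_ereal p))
             powr (1 / real_of_ereal p))"

definition sofic_Map ::
    "'a topology \<Rightarrow> ('g \<Rightarrow> 'a \<Rightarrow> 'a) \<Rightarrow> ('a \<Rightarrow> 'a \<Rightarrow> real) \<Rightarrow> 'g set \<Rightarrow> real \<Rightarrow> nat
       \<Rightarrow> ('g \<Rightarrow> nat \<Rightarrow> nat) \<Rightarrow> (nat \<Rightarrow> 'a) set" where
  "sofic_Map X act \<rho> F \<delta> d \<sigma> =
     {\<phi> \<in> {1..d} \<rightarrow>\<^sub>E topspace X.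
        \<forall>s\<in>F. lp_dist 2 d \<rho> (\<phi> \<circ> \<sigma> s) (\<lambda>v. act s (\<phi> v)) < \<delta>}"

definition sofic_h ::
    "('g, 'b) monoid_scheme \<Rightarrow> 'a topology \<Rightarrow> ('g \<Rightarrow> 'a \<Rightarrow> 'a) \<Rightarrow> (nat \<Rightarrow> nat)
       \<Rightarrow> (nat \<Rightarrow> 'g \<Rightarrow> nat \<Rightarrow> nat) \<Rightarrow> ereal \<Rightarrow> real \<Rightarrow> ('a \<Rightarrow> 'a \<Rightarrow> real) \<Rightarrow> ereal" where
  "sofic_h G X act d \<sigma> p \<epsilon> \<rho> =
     (INF F\<in>{F. finite F \<and> F \<noteq> {} \<and> F \<subseteq> carrier G}. INF \<delta>\<in>{0<..}.
        limsup (\<lambda>i. log_enat (spanning_number (sofic_Map X act \<rho> F \<delta> (d i) (\<sigma> i))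
                                 (lp_dist p (d i) \<rho>) \<epsilon>) / ereal (real (d i))))"

definition lower_mdim ::
    "('g, 'b) monoid_scheme \<Rightarrow> 'a topology \<Rightarrow> ('g \<Rightarrow> 'a \<Rightarrow> 'a) \<Rightarrow> (nat \<Rightarrow> nat)
       \<Rightarrow> (nat \<Rightarrow> 'g \<Rightarrow> nat \<Rightarrow> nat) \<Rightarrow> ereal \<Rightarrow> ('a \<Rightarrow> 'a \<Rightarrow> real) \<Rightarrow> ereal" where
  "lower_mdim G X act d \<sigma> p \<rho> =
     Liminf (at_right 0) (\<lambda>\<epsilon>. sofic_h G X act d \<sigma> p \<epsilon> \<rho> / ereal (ln (1 / \<epsilon>)))"

definition mdim_M ::
    "('g, 'b) monoid_scheme \<Rightarrow> 'a topology \<Rightarrow> ('g \<Rightarrow> 'a \<Rightarrow> 'a) \<Rightarrow> (nat \<Rightarrow> nat)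
       \<Rightarrow> (nat \<Rightarrow> 'g \<Rightarrow> nat \<Rightarrow> nat) \<Rightarrow> ereal \<Rightarrow> ereal" where
  "mdim_M G X act d \<sigma> p =
     (INF \<rho>\<in>{\<rho>. continuous_pseudometric X \<rho> \<and> dynamically_generating G X act \<rho>}.
        lower_mdim G X act d \<sigma> p \<rho>)"

text \<open>The common value of \<open>mdim_M\<close> over all exponents \<open>p\<close> in \<open>[1, \<infinity>]\<close>. That there is one is
  a theorem; in particular it is the value at \<open>p = \<infinity>\<close>.\<close>

definition sofic_D ::
    "('g, 'b) monoid_scheme \<Rightarrow> 'a topology \<Rightarrow> ('g \<Rightarrow> 'a \<Rightarrow> 'a) \<Rightarrow> (nat \<Rightarrow> nat)
       \<Rightarrow> (nat \<Rightarrow> 'g \<Rightarrow> nat \<Rightarrow> nat) \<Rightarrow> ereal" where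
  "sofic_D G X act d \<sigma> = (THE D. \<forall>p\<ge>1. mdim_M G X act d \<sigma> p = D)"

text \<open>The functions \<open>f\<^sub>1, f\<^sub>2, \<dots>\<close> are indexed from 0 here, so \<open>f n\<close> carries the weight
  \<open>2\<^sup>-\<^sup>(\<^sup>n\<^sup>+\<^sup>1\<^sup>)\<close>.\<close>

definition hilbert_cube_metrics :: "'a topology \<Rightarrow> ('a \<Rightarrow> 'a \<Rightarrow> real) set" where
  "hilbert_cube_metrics X =
     {(\<lambda>x y. \<Sum>n. (1 / 2) ^ Suc n * \<bar>f n x - f n y\<bar>) |f :: nat \<Rightarrow> 'a \<Rightarrow> real.
        (\<forall>n. continuous_map X (top_of_set {0..1}) (f n)) \<and>
        (\<forall>x\<in>topspace X. \<forall>y\<in>topspace X. x \<noteq> y \<longrightarrow> (\<exists>n. f n x \<noteq> f n y))}"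

end

theory Submission
  imports Defs "HOL-Real_Asymp.Real_Asymp"
begin

text \<open>
  Write \<open>D\<^sub>p\<close> for the infimum of the lower \<open>p\<close>-metric mean dimension over all dynamically
  generating continuous pseudometrics, and \<open>H\<^sub>p\<close> for the infimum over the Hilbert-cube metrics.
  Power means increase with the exponent and a Hilbert-cube metric is dynamically generating, so
  \<open>D\<^sub>1 \<le> D\<^sub>p \<le> H\<^sub>p \<le> H\<^sub>\<infinity>\<close> for every \<open>p \<ge> 1\<close>. Everything, including the fact that \<open>D\<^sub>p\<close> does
  not depend on \<open>p\<close>, follows once \<open>H\<^sub>\<infinity> \<le> D\<^sub>1\<close> is known. Given a dynamically generating
  \<open>\<rho>\<close>, this is obtained by producing one Hilbert-cube metric \<open>\<rho>'\<close> whose lower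
  \<open>\<infinity>\<close>-metric mean dimension is at most the lower 1-metric mean dimension of \<open>\<rho>\<close>.

  \<^bold>\<open>The metric.\<close> Take the coordinates \<open>f\<^sub>n(x) = min(1, \<rho>(s\<^sub>n x, z\<^sub>n))\<close>, where \<open>(s\<^sub>n, z\<^sub>n)\<close> runs
  over the product of the group with a countable \<open>\<rho>\<close>-dense set; they separate points because
  \<open>\<rho>\<close> is dynamically generating. For approximately equivariant maps \<open>\<phi>, \<psi>\<close> the average
  of \<open>\<rho>(s\<^sub>n \<phi>(v), s\<^sub>n \<psi>(v))\<close> is almost the average of
  \<open>\<rho>(\<phi>(\<sigma>(v)), \<psi>(\<sigma>(v)))\<close>, with \<open>\<sigma>\<close> the permutation attached to \<open>s\<^sub>n\<close>, and a
  permutation does not change an average. Hence \<open>\<rho>'\<^sub>1(\<phi>, \<psi>)\<close> is at most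
  \<open>\<rho>\<^sub>1(\<phi>, \<psi>)\<close> up to a small error, and spanning sets for \<open>\<rho>\<^sub>1\<close> bound spanning numbers
  for \<open>\<rho>'\<^sub>1\<close> at a comparable scale (\<open>sofic_h_translated_hilbert_metric_le\<close>). It matters that the
  comparison is made with averages: a few bad points \<open>v\<close> are harmless for \<open>\<rho>\<^sub>1\<close> but not for
  \<open>\<rho>\<^sub>\<infinity>\<close>.

  \<^bold>\<open>From averages to maxima.\<close> Hilbert-cube metrics have tame covering numbers: the space splits
  into \<open>exp(O(log\<^sup>2(1/\<epsilon>)))\<close> pieces of diameter \<open>O(\<epsilon>)\<close>
  (\<open>hilbert_metric_finite_code\<close>). If \<open>\<rho>'\<^sub>1(e, \<phi>) < \<epsilon>\<close> then, by Markov's inequality,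
  \<open>\<rho>'(e(v), \<phi>(v)) < \<epsilon> L\<^sup>2\<close> with \<open>L = log(1/\<epsilon>)\<close> outside a set of at most \<open>d/L\<^sup>2\<close>
  points \<open>v\<close>. Recording that set costs a factor \<open>2\<^sup>d\<close>, and recording the piece that contains
  \<open>\<phi>(v)\<close> for each of its points costs \<open>exp(O(L\<^sup>2) d/L\<^sup>2)\<close>. Per point of \<open>{1..d}\<close> this adds a
  constant to the entropy, which disappears after division by \<open>L\<close>, and the loss from \<open>\<epsilon>\<close> to
  \<open>\<epsilon> L\<^sup>2\<close> in the scale changes \<open>log(1/\<epsilon>)\<close> by a factor tending to 1
  (\<open>Liminf_growth_rate_rescale\<close>).
\<close>

section \<open>Normalised power means\<close>

lemma pseudometric_onD:
  assumes "pseudometric_on M \<rho>"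
  shows pseudometric_on_nonneg: "x \<in> M \<Longrightarrow> y \<in> M \<Longrightarrow> 0 \<le> \<rho> x y"
    and pseudometric_on_self: "x \<in> M \<Longrightarrow> \<rho> x x = 0"
    and pseudometric_on_commute: "x \<in> M \<Longrightarrow> y \<in> M \<Longrightarrow> \<rho> x y = \<rho> y x"
    and pseudometric_on_triangle: "x \<in> M \<Longrightarrow> y \<in> M \<Longrightarrow> z \<in> M \<Longrightarrow> \<rho> x z \<le> \<rho> x y + \<rho> y z"
  using assms unfolding pseudometric_on_def by blast+

text \<open>
  Convexity of \<open>t \<mapsto> t\<^sup>q\<close> at \<open>t = 1\<close>, in the form of Young's inequality for \<open>t \<cdot> 1\<close>. It holds at
  \<open>t = 0\<close> too, which matters because distances vanish; summed over the entries divided by their mean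
  it gives the comparison of power means below.
\<close>
lemma powr_ge_tangent_at_one:
  fixes t q :: real
  assumes "0 \<le> t" "1 \<le> q"
  shows "1 + q * (t - 1) \<le> t powr q"
proof (cases "q = 1")
  case True
  then show ?thesis using assms by simp
next
  case False
  then have q: "1 < q" using assms by simp
  have "t * 1 \<le> t powr q / q + 1 powr (q / (q - 1)) / (q / (q - 1))"
    by (rule Youngs_inequality) (use q assms in \<open>auto simp: field_simps\<close>)
  then have "t \<le> t powr q / q + (q - 1) / q"
    by simp
  then have "t \<le> (t powr q + (q - 1)) / q"
    by (simp only: add_divide_distrib)
  then have "q * t \<le> t powr q + (q - 1)"
    using q by (simp add: pos_le_divide_eq mult.commute)
  then show ?thesis by (simp add: algebra_simps)
qed

lemma lp_dist_one:
  assumes "\<forall>v\<in>{1..d}. 0 \<le> \<rho> (\<phi> v) (\<psi> v)"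
  shows "lp_dist 1 d \<rho> \<phi> \<psi> = (\<Sum>v=1..d. \<rho> (\<phi> v) (\<psi> v)) / real d"
proof -
  have "(\<Sum>v=1..d. \<rho> (\<phi> v) (\<psi> v) powr 1) = (\<Sum>v=1..d. \<rho> (\<phi> v) (\<psi> v))"
    by (rule sum.cong) (use assms in auto)
  moreover have "0 \<le> (\<Sum>v=1..d. \<rho> (\<phi> v) (\<psi> v))"
    by (rule sum_nonneg) (use assms in auto)
  ultimately show ?thesis
    by (simp add: lp_dist_def one_ereal_def)
qed

lemma lp_dist_two:
  assumes "\<forall>v\<in>{1..d}. 0 \<le> \<rho> (\<phi> v) (\<psi> v)"
  shows "lp_dist 2 d \<rho> \<phi> \<psi> = sqrt ((\<Sum>v=1..d. (\<rho> (\<phi> v) (\<psi> v))\<^sup>2) / real d)"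
proof -
  have 2: "real_of_ereal 2 = 2"
    by (metis numeral_eq_ereal real_of_ereal.simps(1))
  have "(\<Sum>v=1..d. \<rho> (\<phi> v) (\<psi> v) powr 2) = (\<Sum>v=1..d. (\<rho> (\<phi> v) (\<psi> v))\<^sup>2)"
    by (rule sum.cong) (use assms in \<open>auto simp: powr_numeral\<close>)
  moreover have "0 \<le> (\<Sum>v=1..d. (\<rho> (\<phi> v) (\<psi> v))\<^sup>2)"
    by (rule sum_nonneg) auto
  ultimately show ?thesis
    by (simp add: lp_dist_def 2 powr_half_sqrt)
qed

lemma lp_dist_infinity_less_iff:
  assumes "1 \<le> d"
  shows "lp_dist \<infinity> d \<rho> \<phi> \<psi> < r \<longleftrightarrow> (\<forall>v\<in>{1..d}. \<rho> (\<phi> v) (\<psi> v) < r)"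
  using assms by (simp add: lp_dist_def)

lemma lp_dist_one_le:
  assumes nn: "\<forall>v\<in>{1..d}. 0 \<le> \<rho> (\<phi> v) (\<psi> v)" and d: "1 \<le> d" and "1 \<le> p"
  shows "lp_dist 1 d \<rho> \<phi> \<psi> \<le> lp_dist p d \<rho> \<phi> \<psi>"
proof (cases p)
  case PInf
  have "(\<Sum>v=1..d. \<rho> (\<phi> v) (\<psi> v)) \<le> of_nat (card {1..d}) * lp_dist \<infinity> d \<rho> \<phi> \<psi>"
    by (rule sum_bounded_above) (simp add: lp_dist_def)
  then have "(\<Sum>v=1..d. \<rho> (\<phi> v) (\<psi> v)) / real d \<le> lp_dist \<infinity> d \<rho> \<phi> \<psi>"
    using d by (simp add: field_simps)
  then show ?thesis
    using nn by (simp only: lp_dist_one PInf)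
next
  case (real q)
  then have q: "1 \<le> q" using \<open>1 \<le> p\<close> by simp
  define a where "a v = \<rho> (\<phi> v) (\<psi> v)" for v
  define m where "m = (\<Sum>v=1..d. a v) / real d"
  have a: "0 \<le> a v" if "v \<in> {1..d}" for v using nn that by (simp add: a_def)
  have lp: "lp_dist p d \<rho> \<phi> \<psi> = (1 / real d * (\<Sum>v=1..d. a v powr q)) powr (1 / q)"
    by (simp add: lp_dist_def real a_def)
  have l1: "lp_dist 1 d \<rho> \<phi> \<psi> = m"
    using nn by (simp add: lp_dist_one m_def a_def)
  show ?thesis
  proof (cases "m = 0")
    case True
    then show ?thesis by (simp add: l1 lp)
  next
    case False
    have "0 \<le> m"
      unfolding m_def by (intro divide_nonneg_nonneg sum_nonneg a) auto
    with False have m: "0 < m" by simp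
    have sum_a: "(\<Sum>v=1..d. a v) = m * real d"
      using d by (simp add: m_def)
    \<comment> \<open>the linear terms cancel because \<open>m\<close> is the mean of the \<open>a v\<close>\<close>
    have "real d = (\<Sum>v=1..d. 1 + q * (a v / m - 1))"
      using m sum_a by (simp add: sum.distrib sum_distrib_left[symmetric] sum_subtractf
          sum_divide_distrib[symmetric])
    also have "\<dots> \<le> (\<Sum>v=1..d. (a v / m) powr q)"
      by (intro sum_mono powr_ge_tangent_at_one) (use a m q in auto)
    also have "\<dots> = (\<Sum>v=1..d. a v powr q) / m powr q"
      using a m by (simp add: powr_divide sum_divide_distrib)
    finally have "m powr q \<le> 1 / real d * (\<Sum>v=1..d. a v powr q)"
      using m d by (simp add: field_simps)
    then have "(m powr q) powr (1 / q) \<le> (1 / real d * (\<Sum>v=1..d. a v powr q)) powr (1 / q)"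
      by (intro powr_mono2) (use q in auto)
    then show ?thesis
      using m q by (simp add: l1 lp powr_powr)
  qed
qed (use \<open>1 \<le> p\<close> in auto)

lemma lp_dist_le_infinity:
  assumes nn: "\<forall>v\<in>{1..d}. 0 \<le> \<rho> (\<phi> v) (\<psi> v)" and d: "1 \<le> d" and "1 \<le> p"
  shows "lp_dist p d \<rho> \<phi> \<psi> \<le> lp_dist \<infinity> d \<rho> \<phi> \<psi>"
proof (cases p)
  case (real q)
  then have q: "1 \<le> q" using \<open>1 \<le> p\<close> by simp
  define M where "M = lp_dist \<infinity> d \<rho> \<phi> \<psi>"
  have M: "\<rho> (\<phi> v) (\<psi> v) \<le> M" if "v \<in> {1..d}" for v
    using that by (auto simp: M_def lp_dist_def)
  have M0: "0 \<le> M"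
    using bspec[OF nn, of 1] M[of 1] d by auto
  have "(\<Sum>v=1..d. \<rho> (\<phi> v) (\<psi> v) powr q) \<le> of_nat (card {1..d}) * M powr q"
    by (rule sum_bounded_above) (use M nn q in \<open>auto intro: powr_mono2\<close>)
  then have *: "1 / real d * (\<Sum>v=1..d. \<rho> (\<phi> v) (\<psi> v) powr q) \<le> M powr q"
    using d by (simp add: field_simps)
  have "lp_dist p d \<rho> \<phi> \<psi> = (1 / real d * (\<Sum>v=1..d. \<rho> (\<phi> v) (\<psi> v) powr q)) powr (1 / q)"
    by (simp add: lp_dist_def real)
  also have "\<dots> \<le> (M powr q) powr (1 / q)"
    by (intro powr_mono2 *) (use q in \<open>auto intro!: divide_nonneg_nonneg sum_nonneg\<close>)
  also have "\<dots> = M"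
    using M0 q by (simp add: powr_powr)
  finally show ?thesis by (simp add: M_def)
qed (use \<open>1 \<le> p\<close> in auto)

text \<open>
  Up to a small error, translating an approximately equivariant map by a group element amounts to
  precomposing it with a permutation, so this invariance makes translation harmless on average.
\<close>
lemma lp_dist_one_permute:
  assumes "\<forall>v\<in>{1..d}. 0 \<le> \<rho> (\<phi> v) (\<psi> v)" and s: "s permutes {1..d}"
  shows "lp_dist 1 d \<rho> (\<phi> \<circ> s) (\<psi> \<circ> s) = lp_dist 1 d \<rho> \<phi> \<psi>"
proof -
  have "(\<Sum>v=1..d. \<rho> (\<phi> (s v)) (\<psi> (s v))) = (\<Sum>v=1..d. \<rho> (\<phi> v) (\<psi> v))"
    using sum.permute[OF s, of "\<lambda>v. \<rho> (\<phi> v) (\<psi> v)"] by (simp add: o_def)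
  moreover have "\<forall>v\<in>{1..d}. 0 \<le> \<rho> ((\<phi> \<circ> s) v) ((\<psi> \<circ> s) v)"
    using assms permutes_in_image[OF s] by (metis comp_apply)
  ultimately show ?thesis
    by (simp add: lp_dist_one assms(1))
qed

lemma lp_dist_one_triangle:
  assumes \<rho>: "pseudometric_on M \<rho>"
    and in_M: "\<phi> \<in> {1..d} \<rightarrow> M" "\<psi> \<in> {1..d} \<rightarrow> M" "\<omega> \<in> {1..d} \<rightarrow> M"
  shows "lp_dist 1 d \<rho> \<phi> \<omega> \<le> lp_dist 1 d \<rho> \<phi> \<psi> + lp_dist 1 d \<rho> \<psi> \<omega>"
proof -
  have M: "\<phi> v \<in> M" "\<psi> v \<in> M" "\<omega> v \<in> M" if "v \<in> {1..d}" for v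
    using in_M that by auto
  have "(\<Sum>v=1..d. \<rho> (\<phi> v) (\<omega> v)) \<le> (\<Sum>v=1..d. \<rho> (\<phi> v) (\<psi> v) + \<rho> (\<psi> v) (\<omega> v))"
    by (rule sum_mono) (use \<rho> M in \<open>unfold pseudometric_on_def, blast\<close>)
  moreover have "\<forall>v\<in>{1..d}. 0 \<le> \<rho> (\<phi> v) (\<psi> v)" "\<forall>v\<in>{1..d}. 0 \<le> \<rho> (\<phi> v) (\<omega> v)"
    "\<forall>v\<in>{1..d}. 0 \<le> \<rho> (\<psi> v) (\<omega> v)"
    using \<rho> M unfolding pseudometric_on_def by blast+
  ultimately show ?thesis
    by (simp add: lp_dist_one sum.distrib add_divide_distrib[symmetric] divide_right_mono)
qed

lemma lp_dist_one_commute: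
  assumes \<rho>: "pseudometric_on M \<rho>" and in_M: "\<phi> \<in> {1..d} \<rightarrow> M" "\<psi> \<in> {1..d} \<rightarrow> M"
  shows "lp_dist 1 d \<rho> \<phi> \<psi> = lp_dist 1 d \<rho> \<psi> \<phi>"
proof -
  have "(\<Sum>v=1..d. \<rho> (\<phi> v) (\<psi> v) powr 1) = (\<Sum>v=1..d. \<rho> (\<psi> v) (\<phi> v) powr 1)"
    by (rule sum.cong) (use \<rho> in_M in \<open>simp_all add: pseudometric_on_def Pi_iff\<close>)
  then show ?thesis by (simp add: lp_dist_def one_ereal_def)
qed

section \<open>Growth rates under a change of scale\<close>

text \<open>
  A lower growth rate tolerates an additive error in the counted quantity and any change of scale that
  is negligible on the logarithmic axis. If the left growth rate exceeds \<open>c' > c\<close>, then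
  \<open>c' ln(1/g \<epsilon>) < b \<epsilon> + K\<close> for small \<open>\<epsilon>\<close>, and the left side exceeds \<open>c ln(1/\<epsilon>) + K\<close>
  because their difference is \<open>ln(1/\<epsilon>)\<close> times something that tends to \<open>c' - c > 0\<close>. Only real
  bounds \<open>c, c'\<close> enter, so infinite values of \<open>a\<close> and \<open>b\<close> need no separate treatment.
\<close>
lemma Liminf_growth_rate_rescale:
  fixes a b :: "real \<Rightarrow> ereal" and g :: "real \<Rightarrow> real" and K :: real
  assumes g: "filterlim g (at_right 0) (at_right 0)"
    and ratio: "((\<lambda>\<epsilon>. ln (1 / g \<epsilon>) / ln (1 / \<epsilon>)) \<longlongrightarrow> 1) (at_right 0)"
    and le: "\<forall>\<^sub>F \<epsilon> in at_right 0. a (g \<epsilon>) \<le> b \<epsilon> + ereal K"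
  shows "Liminf (at_right 0) (\<lambda>\<epsilon>. a \<epsilon> / ereal (ln (1 / \<epsilon>)))
       \<le> Liminf (at_right 0) (\<lambda>\<epsilon>. b \<epsilon> / ereal (ln (1 / \<epsilon>)))" (is "?A \<le> ?B")
  unfolding le_Liminf_iff
proof (intro allI impI)
  fix y assume "y < ?A"
  then obtain c where "y < ereal c" "ereal c < ?A"
    using ereal_dense2 by blast
  then obtain c' where "ereal c < ereal c'" and c'A: "ereal c' < ?A"
    using ereal_dense2 by blast
  then have cc': "c < c'" by simp
  have pos: "\<forall>\<^sub>F \<epsilon> in at_right 0. 0 < ln (1 / \<epsilon> :: real)"
    by real_asymp
  have pos': "\<forall>\<^sub>F \<epsilon> in at_right 0. 0 < ln (1 / g \<epsilon>)"
    using eventually_compose_filterlim[OF pos g] .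
  have large: "filterlim (\<lambda>\<epsilon>. (c' * (ln (1 / g \<epsilon>) / ln (1 / \<epsilon>)) - c) * ln (1 / \<epsilon>)) at_top (at_right 0)"
  proof (rule filterlim_tendsto_pos_mult_at_top)
    show "((\<lambda>\<epsilon>. c' * (ln (1 / g \<epsilon>) / ln (1 / \<epsilon>)) - c) \<longlongrightarrow> c' * 1 - c) (at_right 0)"
      by (intro tendsto_intros ratio)
    show "filterlim (\<lambda>\<epsilon>. ln (1 / \<epsilon> :: real)) at_top (at_right 0)"
      by real_asymp
  qed (use cc' in simp)
  have "\<forall>\<^sub>F \<epsilon> in at_right 0. ereal c' < a \<epsilon> / ereal (ln (1 / \<epsilon>))"
    using c'A by (rule less_LiminfD)
  from eventually_compose_filterlim[OF this g]
  have "\<forall>\<^sub>F \<epsilon> in at_right 0. ereal c' < a (g \<epsilon>) / ereal (ln (1 / g \<epsilon>))" .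
  then show "\<forall>\<^sub>F \<epsilon> in at_right 0. y < b \<epsilon> / ereal (ln (1 / \<epsilon>))"
    using le pos pos' filterlim_at_top_dense[THEN iffD1, OF large, rule_format, of K]
  proof eventually_elim
    case (elim \<epsilon>)
    have "ereal (c * ln (1 / \<epsilon>) + K) < ereal (c' * ln (1 / g \<epsilon>))"
      using elim by (simp add: algebra_simps)
    also have "\<dots> = ereal c' * ereal (ln (1 / g \<epsilon>))" by simp
    also have "\<dots> < a (g \<epsilon>)"
      using elim by (subst (asm) ereal_less_divide_iff) auto
    also have "\<dots> \<le> b \<epsilon> + ereal K" by fact
    finally have "ereal (c * ln (1 / \<epsilon>)) < b \<epsilon>"
      by (cases "b \<epsilon>") auto
    then have "ereal c < b \<epsilon> / ereal (ln (1 / \<epsilon>))"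
      using elim by (subst ereal_less_divide_iff) auto
    with \<open>y < ereal c\<close> show ?case by simp
  qed
qed

lemma rescale_log_squared:
  shows "filterlim (\<lambda>\<epsilon>::real. 2 * (\<epsilon> * (ln (1 / \<epsilon>))\<^sup>2)) (at_right 0) (at_right 0)"
    and "((\<lambda>\<epsilon>::real. ln (1 / (2 * (\<epsilon> * (ln (1 / \<epsilon>))\<^sup>2))) / ln (1 / \<epsilon>)) \<longlongrightarrow> 1) (at_right 0)"
    and "\<forall>\<^sub>F \<epsilon>::real in at_right 0. 1 \<le> ln (1 / \<epsilon>)"
  by real_asymp+

lemma rescale_constant:
  shows "filterlim (\<lambda>\<epsilon>::real. 5 * \<epsilon>) (at_right 0) (at_right 0)"
    and "((\<lambda>\<epsilon>::real. ln (1 / (5 * \<epsilon>)) / ln (1 / \<epsilon>)) \<longlongrightarrow> 1) (at_right 0)"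
  by real_asymp+

section \<open>Hilbert-cube metrics\<close>

definition hilbert_metric :: "(nat \<Rightarrow> 'a \<Rightarrow> real) \<Rightarrow> 'a \<Rightarrow> 'a \<Rightarrow> real" where
  "hilbert_metric f x y = (\<Sum>n. (1 / 2) ^ Suc n * \<bar>f n x - f n y\<bar>)"

lemma hilbert_cube_metrics_eq:
  "hilbert_cube_metrics X = hilbert_metric `
     {f. (\<forall>n. continuous_map X (top_of_set {0..1}) (f n)) \<and>
         (\<forall>x\<in>topspace X. \<forall>y\<in>topspace X. x \<noteq> y \<longrightarrow> (\<exists>n. f n x \<noteq> f n y))}"
  unfolding hilbert_cube_metrics_def by (auto simp: hilbert_metric_def [abs_def])

lemma sum_half_powers: "(\<Sum>n<N. (1 / 2 :: real) ^ Suc n) = 1 - (1 / 2) ^ N"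
  by (induction N) (auto simp: field_simps)

context
  fixes X :: "'a topology" and f :: "nat \<Rightarrow> 'a \<Rightarrow> real"
  assumes f: "\<And>n. continuous_map X (top_of_set {0..1}) (f n)"
begin

lemma hilbert_coordinate_diff_le_1:
  assumes "x \<in> topspace X" "y \<in> topspace X"
  shows "\<bar>f n x - f n y\<bar> \<le> 1"
proof -
  have "f n x \<in> {0..1}" "f n y \<in> {0..1}"
    using f[of n] assms by (auto simp: continuous_map_in_subtopology)
  then show ?thesis by auto
qed

lemma hilbert_metric_partial_sum:
  assumes "x \<in> topspace X" "y \<in> topspace X"
  shows hilbert_metric_summable: "summable (\<lambda>n. (1 / 2) ^ Suc n * \<bar>f n x - f n y\<bar>)"
    and hilbert_metric_ge: "(\<Sum>n<N. (1 / 2) ^ Suc n * \<bar>f n x - f n y\<bar>) \<le> hilbert_metric f x y"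
    and hilbert_metric_le:
      "hilbert_metric f x y \<le> (\<Sum>n<N. (1 / 2) ^ Suc n * \<bar>f n x - f n y\<bar>) + (1 / 2) ^ N"
proof -
  let ?t = "\<lambda>n. (1 / 2 :: real) ^ Suc n * \<bar>f n x - f n y\<bar>"
  have t_le: "?t n \<le> (1 / 2) ^ Suc n" for n
    using hilbert_coordinate_diff_le_1[OF assms, of n] by (intro mult_left_le) auto
  have geo: "summable (\<lambda>n. (1 / 2 :: real) ^ n)"
    by (rule summable_geometric) simp
  have geo': "summable (\<lambda>n. (1 / 2 :: real) ^ Suc n)"
    using summable_ignore_initial_segment[OF geo, of 1] by simp
  show sm: "summable ?t"
    by (rule summable_comparison_test'[OF geo', of 0]) (use t_le in auto)
  show "(\<Sum>n<N. ?t n) \<le> hilbert_metric f x y"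
    unfolding hilbert_metric_def by (rule sum_le_suminf[OF sm]) auto
  have "hilbert_metric f x y = (\<Sum>n. ?t (n + N)) + (\<Sum>n<N. ?t n)"
    unfolding hilbert_metric_def by (rule suminf_split_initial_segment[OF sm])
  also have "(\<Sum>n. ?t (n + N)) \<le> (\<Sum>n. (1 / 2) ^ Suc (n + N))"
    by (rule suminf_le)
      (use t_le summable_ignore_initial_segment[OF sm, of N]
           summable_ignore_initial_segment[OF geo', of N] in auto)
  also have "(\<Sum>n. (1 / 2 :: real) ^ Suc (n + N)) = (\<Sum>n. (1 / 2) ^ Suc N * (1 / 2) ^ n)"
    by (simp add: power_add mult_ac)
  also have "\<dots> = (1 / 2) ^ N"
    by (subst suminf_mult[OF geo]) (simp add: suminf_geometric)
  finally show "hilbert_metric f x y \<le> (\<Sum>n<N. ?t n) + (1 / 2) ^ N" by simp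
qed

lemma continuous_pseudometric_hilbert_metric: "continuous_pseudometric X (hilbert_metric f)"
proof -
  note summ = hilbert_metric_summable
  have "hilbert_metric f x z \<le> hilbert_metric f x y + hilbert_metric f y z"
    if "x \<in> topspace X" "y \<in> topspace X" "z \<in> topspace X" for x y z
    unfolding hilbert_metric_def
    by (subst suminf_add[OF summ summ]; (intro suminf_le summable_add summ)?)
      (use that in \<open>auto simp: distrib_left[symmetric] intro!: mult_left_mono\<close>)
  moreover have "0 \<le> hilbert_metric f x y" if "x \<in> topspace X" "y \<in> topspace X" for x y
    using hilbert_metric_ge[OF that, of 0] by simp
  moreover have "hilbert_metric f x y = hilbert_metric f y x" for x y
    by (simp add: hilbert_metric_def abs_minus_commute)
  moreover have "hilbert_metric f x x = 0" for x
    by (simp add: hilbert_metric_def)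
  ultimately have "pseudometric_on (topspace X) (hilbert_metric f)"
    unfolding pseudometric_on_def by blast
  moreover have "continuous_map (prod_topology X X) euclideanreal (\<lambda>(x, y). hilbert_metric f x y)"
  proof -
    let ?S = "\<lambda>N p. \<Sum>n<N. (1 / 2 :: real) ^ Suc n * \<bar>f n (fst p) - f n (snd p)\<bar>"
    have fR: "continuous_map X euclideanreal (f n)" for n
      using f[of n] by (simp add: continuous_map_in_subtopology)
    have "continuous_map (prod_topology X X) Met_TC.mtopology (\<lambda>p. hilbert_metric f (fst p) (snd p))"
    proof (rule Met_TC.continuous_map_uniform_limit_alt[where F=sequentially and f="?S"])
      show "\<forall>\<^sub>F N in sequentially. continuous_map (prod_topology X X) Met_TC.mtopology (?S N)"
        unfolding mtopology_is_euclidean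
        by (intro always_eventually allI continuous_intros continuous_map_real_mult_left
            continuous_map_compose[OF continuous_map_fst fR, unfolded o_def]
            continuous_map_compose[OF continuous_map_snd fR, unfolded o_def]) auto
      fix \<epsilon> :: real assume "0 < \<epsilon>"
      have "\<forall>\<^sub>F N in sequentially. (1 / 2 :: real) ^ N < \<epsilon>"
        by (rule order_tendstoD[OF LIMSEQ_power_zero]) (use \<open>0 < \<epsilon>\<close> in auto)
      then show "\<forall>\<^sub>F N in sequentially. \<forall>p\<in>topspace (prod_topology X X).
                   dist (?S N p) (hilbert_metric f (fst p) (snd p)) < \<epsilon>"
      proof eventually_elim
        case (elim N)
        show ?case
        proof
          fix p assume "p \<in> topspace (prod_topology X X)"
          then have "fst p \<in> topspace X" "snd p \<in> topspace X" by auto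
          from hilbert_metric_ge[OF this, of N] hilbert_metric_le[OF this, of N] elim
          show "dist (?S N p) (hilbert_metric f (fst p) (snd p)) < \<epsilon>"
            by (simp add: dist_real_def)
        qed
      qed
    qed auto
    then show ?thesis
      by (simp add: case_prod_beta')
  qed
  ultimately show ?thesis
    by (simp add: continuous_pseudometric_def)
qed

lemma hilbert_metric_pos:
  assumes "x \<in> topspace X" "y \<in> topspace X" "f n x \<noteq> f n y"
  shows "0 < hilbert_metric f x y"
proof -
  have "0 < (1 / 2 :: real) ^ Suc n * \<bar>f n x - f n y\<bar>" using assms by simp
  also have "\<dots> \<le> (\<Sum>k<Suc n. (1 / 2) ^ Suc k * \<bar>f k x - f k y\<bar>)"
    by (rule member_le_sum) auto
  also have "\<dots> \<le> hilbert_metric f x y"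
    by (rule hilbert_metric_ge[OF assms(1,2)])
  finally show ?thesis .
qed

text \<open>
  Tame growth of covering numbers. The code of a point consists of its first \<open>N\<close> coordinates rounded
  down to multiples of \<open>2\<^sup>-\<^sup>N\<close>. Points with the same code differ by at most \<open>2\<^sup>-\<^sup>N\<close> in those
  coordinates, and the remaining coordinates contribute at most \<open>2\<^sup>-\<^sup>N\<close>. There are at most
  \<open>(2\<^sup>N + 1)\<^sup>N\<close> codes, so the logarithm of their number is quadratic in the logarithm of the scale.
\<close>
lemma hilbert_metric_finite_code:
  obtains \<kappa> :: "'a \<Rightarrow> nat \<Rightarrow> nat" and C
  where "finite C" "card C \<le> 2 ^ (N * (N + 1))" "\<kappa> ` topspace X \<subseteq> C"
    and "\<And>x y. x \<in> topspace X \<Longrightarrow> y \<in> topspace X \<Longrightarrow> \<kappa> x = \<kappa> y \<Longrightarrow> hilbert_metric f x y \<le> 2 * (1 / 2) ^ N"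
proof
  let ?C = "{..<N} \<rightarrow>\<^sub>E {0..(2::nat) ^ N}"
  define \<kappa> where "\<kappa> x = (\<lambda>k\<in>{..<N}. nat \<lfloor>2 ^ N * f k x\<rfloor>)" for x
  have range: "0 \<le> f k x" "f k x \<le> 1" if "x \<in> topspace X" for k x
    using f[of k] that by (auto simp: continuous_map_in_subtopology)
  show "finite ?C" by (intro finite_PiE) auto
  have "card ?C = (2 ^ N + 1) ^ N"
    by (simp add: card_PiE)
  also have "\<dots> \<le> (2 ^ (N + 1)) ^ N"
    by (rule power_mono) auto
  finally show "card ?C \<le> 2 ^ (N * (N + 1))"
    by (simp add: power_mult[symmetric] power_add mult.commute)
  show "\<kappa> ` topspace X \<subseteq> ?C"
  proof
    fix c assume "c \<in> \<kappa> ` topspace X"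
    then obtain x where x: "x \<in> topspace X" "c = \<kappa> x" by blast
    have "nat \<lfloor>2 ^ N * f k x\<rfloor> \<le> 2 ^ N" for k
    proof -
      have "2 ^ N * f k x \<le> 2 ^ N"
        using range[OF x(1), of k] by (intro mult_left_le) auto
      then have "2 ^ N * f k x < 2 ^ N + 1" by linarith
      then show ?thesis by (simp add: nat_le_iff floor_le_iff)
    qed
    then show "c \<in> ?C" by (simp add: x(2) \<kappa>_def)
  qed
  fix x y assume x: "x \<in> topspace X" and y: "y \<in> topspace X" and eq: "\<kappa> x = \<kappa> y"
  have diff: "\<bar>f k x - f k y\<bar> \<le> (1 / 2) ^ N" if "k < N" for k
  proof -
    have "nat \<lfloor>2 ^ N * f k x\<rfloor> = nat \<lfloor>2 ^ N * f k y\<rfloor>"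
      using fun_cong[OF eq, of k] that by (simp add: \<kappa>_def)
    moreover have "0 \<le> \<lfloor>2 ^ N * f k x\<rfloor>" "0 \<le> \<lfloor>2 ^ N * f k y\<rfloor>"
      using range x y by auto
    ultimately have "\<lfloor>2 ^ N * f k x\<rfloor> = \<lfloor>2 ^ N * f k y\<rfloor>"
      by (metis eq_nat_nat_iff)
    then have "\<bar>2 ^ N * f k x - 2 ^ N * f k y\<bar> \<le> 1" by linarith
    then have "2 ^ N * \<bar>f k x - f k y\<bar> \<le> 1"
      by (simp add: abs_mult flip: right_diff_distrib)
    then show ?thesis by (simp add: field_simps power_divide)
  qed
  have "(\<Sum>k<N. (1 / 2) ^ Suc k * \<bar>f k x - f k y\<bar>) \<le> (\<Sum>k<N. (1 / 2) ^ Suc k * (1 / 2) ^ N)"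
    by (intro sum_mono mult_left_mono diff) auto
  also have "\<dots> = (\<Sum>k<N. (1 / 2 :: real) ^ Suc k) * (1 / 2) ^ N"
    by (simp only: sum_distrib_right)
  also have "\<dots> \<le> 1 * (1 / 2) ^ N"
    unfolding sum_half_powers by (intro mult_right_mono) auto
  finally show "hilbert_metric f x y \<le> 2 * (1 / 2) ^ N"
    using hilbert_metric_le[OF x y, of N] by simp
qed

end

section \<open>Continuous pseudometrics on a compact space\<close>

text \<open>
  Squares appear because they can be averaged: the inequality passes from points to the quantities that
  define \<^const>\<open>sofic_Map\<close>. Where \<open>\<rho>\<^sup>2 < \<eta>\<close> there is nothing to show, and on the compact set where
  \<open>\<rho>\<^sup>2 \<ge> \<eta>\<close> the function \<open>\<rho>'\<close> is bounded below by some \<open>m > 0\<close> while \<open>\<rho>\<close> is bounded by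
  some \<open>B\<close>, so that \<open>C = (B/m)\<^sup>2\<close> works.
\<close>
lemma continuous_pseudometric_square_dominated:
  assumes X: "compact_space X"
    and \<rho>: "continuous_pseudometric X \<rho>" and \<rho>': "continuous_pseudometric X \<rho>'"
    and pos: "\<And>x y. x \<in> topspace X \<Longrightarrow> y \<in> topspace X \<Longrightarrow> 0 < \<rho> x y \<Longrightarrow> 0 < \<rho>' x y"
    and "0 < \<eta>"
  obtains C where "0 \<le> C"
    "\<And>x y. x \<in> topspace X \<Longrightarrow> y \<in> topspace X \<Longrightarrow> (\<rho> x y)\<^sup>2 \<le> \<eta> + C * (\<rho>' x y)\<^sup>2"
proof -
  let ?X2 = "prod_topology X X"
  have X2: "compact_space ?X2"
    using X by (simp add: compact_space_prod_topology)
  have c: "continuous_map ?X2 euclideanreal (\<lambda>(x, y). \<rho> x y)"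
    and c': "continuous_map ?X2 euclideanreal (\<lambda>(x, y). \<rho>' x y)"
    and p: "pseudometric_on (topspace X) \<rho>"
    using \<rho> \<rho>' by (auto simp: continuous_pseudometric_def)
  have "compactin euclideanreal ((\<lambda>(x, y). \<rho> x y) ` topspace ?X2)"
    using X2 c image_compactin unfolding compact_space_def by blast
  then have "bounded ((\<lambda>(x, y). \<rho> x y) ` topspace ?X2)"
    by (simp add: compact_imp_bounded)
  then obtain B where B: "\<And>x y. x \<in> topspace X \<Longrightarrow> y \<in> topspace X \<Longrightarrow> \<bar>\<rho> x y\<bar> \<le> B"
    by (force simp: bounded_iff)
  define K where "K = {p \<in> topspace ?X2. (case p of (x, y) \<Rightarrow> \<rho> x y) \<in> {sqrt \<eta>..}}"
  have "closedin ?X2 K"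
    unfolding K_def by (rule closedin_continuous_map_preimage[OF c]) simp
  then have "compactin ?X2 K"
    using X2 closedin_compact_space by blast
  then have cK: "compact ((\<lambda>(x, y). \<rho>' x y) ` K)"
    using c' image_compactin by (metis compactin_euclidean_iff)
  obtain m where m: "0 < m" "\<And>x y. (x, y) \<in> K \<Longrightarrow> m \<le> \<rho>' x y"
  proof (cases "K = {}")
    case False
    then obtain t where "t \<in> (\<lambda>(x, y). \<rho>' x y) ` K" "\<forall>u\<in>(\<lambda>(x, y). \<rho>' x y) ` K. t \<le> u"
      using compact_attains_inf[OF cK] by blast
    then obtain a b where ab: "(a, b) \<in> K" "\<And>x y. (x, y) \<in> K \<Longrightarrow> \<rho>' a b \<le> \<rho>' x y"
      by force
    have "0 < sqrt \<eta>" using \<open>0 < \<eta>\<close> by simp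
    also have "sqrt \<eta> \<le> \<rho> a b" using ab(1) by (simp add: K_def)
    finally have "0 < \<rho>' a b"
      using ab(1) by (intro pos) (auto simp: K_def)
    then show ?thesis using ab(2) by (rule that)
  qed (use that[of 1] in auto)
  show thesis
  proof
    show "0 \<le> (B / m)\<^sup>2" by simp
    fix x y assume xy: "x \<in> topspace X" "y \<in> topspace X"
    show "(\<rho> x y)\<^sup>2 \<le> \<eta> + (B / m)\<^sup>2 * (\<rho>' x y)\<^sup>2"
    proof (cases "sqrt \<eta> \<le> \<rho> x y")
      case True
      then have "(x, y) \<in> K" using xy by (simp add: K_def)
      then have "m \<le> \<rho>' x y" by (rule m)
      have "(\<rho> x y)\<^sup>2 \<le> B\<^sup>2"
        using B[OF xy] by (metis abs_le_square_iff abs_of_nonneg abs_ge_zero order_trans)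
      also have "\<dots> = (B / m)\<^sup>2 * m\<^sup>2"
        using m(1) by (simp add: power_divide)
      also have "\<dots> \<le> (B / m)\<^sup>2 * (\<rho>' x y)\<^sup>2"
        using m(1) \<open>m \<le> \<rho>' x y\<close> by (intro mult_left_mono power_mono) auto
      finally show ?thesis using \<open>0 < \<eta>\<close> by simp
    next
      case False
      then have "(\<rho> x y)\<^sup>2 \<le> (sqrt \<eta>)\<^sup>2"
        using pseudometric_on_nonneg[OF p xy] by (intro power_mono) auto
      moreover have "0 \<le> (B / m)\<^sup>2 * (\<rho>' x y)\<^sup>2"
        by (intro mult_nonneg_nonneg) auto
      moreover have "(sqrt \<eta>)\<^sup>2 = \<eta>" using \<open>0 < \<eta>\<close> by simp
      ultimately show ?thesis by linarith
    qed
  qed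
qed

lemma continuous_pseudometric_separable:
  assumes X: "compact_space X" and \<rho>: "continuous_pseudometric X \<rho>"
  obtains Z where "countable Z" "Z \<subseteq> topspace X"
    "\<And>x \<epsilon>. x \<in> topspace X \<Longrightarrow> 0 < \<epsilon> \<Longrightarrow> \<exists>z\<in>Z. \<rho> x z < \<epsilon>"
proof -
  have p: "pseudometric_on (topspace X) \<rho>"
    using \<rho> by (simp add: continuous_pseudometric_def)
  have "\<exists>F. finite F \<and> F \<subseteq> topspace X \<and> (\<forall>x\<in>topspace X. \<exists>z\<in>F. \<rho> x z < \<epsilon>)" if "0 < \<epsilon>" for \<epsilon>
  proof -
    define U where "U z = {x \<in> topspace X. \<rho> x z \<in> {..<\<epsilon>}}" for z
    have "openin X (U z)" if "z \<in> topspace X" for z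
    proof -
      have "continuous_map X (prod_topology X X) (\<lambda>x. (x, z))"
        using that by (intro continuous_map_pairedI) auto
      from continuous_map_compose[OF this, of euclideanreal "\<lambda>(x, y). \<rho> x y"] \<rho>
      have "continuous_map X euclideanreal (\<lambda>x. \<rho> x z)"
        by (simp add: continuous_pseudometric_def o_def)
      then show ?thesis
        unfolding U_def by (rule openin_continuous_map_preimage) simp
    qed
    moreover have "topspace X \<subseteq> \<Union> (U ` topspace X)"
      using pseudometric_on_self[OF p] \<open>0 < \<epsilon>\<close> by (force simp: U_def)
    ultimately obtain \<F> where "finite \<F>" "\<F> \<subseteq> U ` topspace X" "topspace X \<subseteq> \<Union> \<F>"
      using X unfolding compact_space_alt by (metis (no_types, lifting) imageE)
    then obtain F where "finite F" "F \<subseteq> topspace X" "topspace X \<subseteq> \<Union> (U ` F)"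
      by (metis finite_subset_image)
    then show ?thesis by (fastforce simp: U_def)
  qed
  then obtain F where F: "\<And>\<epsilon>. 0 < \<epsilon> \<Longrightarrow> finite (F \<epsilon>) \<and> F \<epsilon> \<subseteq> topspace X \<and>
      (\<forall>x\<in>topspace X. \<exists>z\<in>F \<epsilon>. \<rho> x z < \<epsilon>)"
    by metis
  show thesis
  proof
    show "countable (\<Union>n. F (1 / real (Suc n)))"
      using F by (intro countable_UN) (auto intro: countable_finite)
    show "(\<Union>n. F (1 / real (Suc n))) \<subseteq> topspace X"
      using F by (simp add: UN_least)
    fix x and \<epsilon> :: real assume x: "x \<in> topspace X" and "0 < \<epsilon>"
    then obtain n where n: "1 / real (Suc n) < \<epsilon>"
      using nat_approx_posE by blast
    with F[of "1 / real (Suc n)"] x obtain z where "z \<in> F (1 / real (Suc n))" "\<rho> x z < 1 / real (Suc n)"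
      by auto
    with n show "\<exists>z\<in>(\<Union>n. F (1 / real (Suc n))). \<rho> x z < \<epsilon>"
      by force
  qed
qed

section \<open>Spanning numbers and their exponential growth\<close>

lemma spanning_number_le:
  assumes "finite E" "spanning Y \<rho> \<epsilon> E"
  shows "spanning_number Y \<rho> \<epsilon> \<le> enat (card E)"
  unfolding spanning_number_def by (rule Inf_lower) (use assms in blast)

text \<open>
  Spanning sets have to lie in the set that they span. Choosing a point in each piece of a cover meets
  this condition, whereas a spanning set of a larger set need not.
\<close>
lemma spanning_number_le_card_cover:
  assumes I: "finite I" and cover: "\<And>y. y \<in> Y \<Longrightarrow> \<exists>j\<in>I. y \<in> U j"
    and small: "\<And>j x y. j \<in> I \<Longrightarrow> x \<in> Y \<Longrightarrow> y \<in> Y \<Longrightarrow> x \<in> U j \<Longrightarrow> y \<in> U j \<Longrightarrow> \<rho> x y < \<epsilon>"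
  shows "spanning_number Y \<rho> \<epsilon> \<le> enat (card I)"
proof -
  define J where "J = {j \<in> I. Y \<inter> U j \<noteq> {}}"
  define x where "x j = (SOME y. y \<in> Y \<inter> U j)" for j
  have x: "x j \<in> Y \<inter> U j" if "j \<in> J" for j
    unfolding x_def by (rule someI_ex) (use that in \<open>auto simp: J_def\<close>)
  have J: "finite J" "card J \<le> card I"
    using I by (auto simp: J_def intro: card_mono)
  have "\<exists>z\<in>x ` J. \<rho> z y < \<epsilon>" if "y \<in> Y" for y
  proof -
    obtain j where j: "j \<in> I" "y \<in> U j" using cover \<open>y \<in> Y\<close> by blast
    then have "j \<in> J" using \<open>y \<in> Y\<close> by (auto simp: J_def)
    then show ?thesis using x[of j] small[of j "x j" y] j \<open>y \<in> Y\<close> by auto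
  qed
  then have "spanning Y \<rho> \<epsilon> (x ` J)"
    using x by (auto simp: spanning_def)
  then have "spanning_number Y \<rho> \<epsilon> \<le> enat (card (x ` J))"
    using J by (intro spanning_number_le) auto
  also have "card (x ` J) \<le> card I"
    using card_image_le[OF J(1), of x] J(2) by linarith
  finally show ?thesis by simp
qed

text \<open>
  The bound is assumed for every finite spanning set \<open>E\<close> and applied to one of least size; if there is
  none, the right-hand side is infinite. When the least size is 0 the bound forces both sides to be
  \<open>-\<infinity>\<close>.
\<close>
lemma log_spanning_number_le:
  assumes d: "1 \<le> d"
    and bound: "\<And>E. finite E \<Longrightarrow> spanning Y \<rho> \<epsilon> E \<Longrightarrow>
      \<exists>M. real M \<le> exp (K * real d) \<and> spanning_number Y' \<rho>' \<epsilon>' \<le> enat (card E * M)"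
  shows "log_enat (spanning_number Y' \<rho>' \<epsilon>') / ereal (real d)
      \<le> log_enat (spanning_number Y \<rho> \<epsilon>) / ereal (real d) + ereal K"
proof (cases "\<exists>E. finite E \<and> spanning Y \<rho> \<epsilon> E")
  case False
  then have "spanning_number Y \<rho> \<epsilon> = \<infinity>"
    by (simp add: spanning_number_def Inf_enat_def)
  then show ?thesis using d by (simp add: log_enat_def)
next
  case True
  let ?A = "{enat (card E) |E. finite E \<and> spanning Y \<rho> \<epsilon> E}"
  have "?A \<noteq> {}" using True by blast
  then have "Inf ?A = (LEAST n. n \<in> ?A)" by (simp only: Inf_enat_def if_False)
  moreover have "(LEAST n. n \<in> ?A) \<in> ?A"
    using \<open>?A \<noteq> {}\<close> LeastI_ex[of "\<lambda>n. n \<in> ?A"] by blast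
  ultimately have "spanning_number Y \<rho> \<epsilon> \<in> ?A"
    by (simp only: spanning_number_def)
  then obtain E where E: "finite E" "spanning Y \<rho> \<epsilon> E" "spanning_number Y \<rho> \<epsilon> = enat (card E)"
    by blast
  obtain M where M: "real M \<le> exp (K * real d)" "spanning_number Y' \<rho>' \<epsilon>' \<le> enat (card E * M)"
    using bound[OF E(1,2)] by blast
  then obtain k where k: "spanning_number Y' \<rho>' \<epsilon>' = enat k" "k \<le> card E * M"
    by (cases "spanning_number Y' \<rho>' \<epsilon>'") auto
  show ?thesis
  proof (cases "k = 0")
    case True
    then show ?thesis using k d by (simp add: log_enat_def)
  next
    case False
    then have "0 < card E * M" using k(2) by linarith
    then have pos: "0 < card E" "0 < M" by simp_all
    have "ln (real k) \<le> ln (real (card E * M))"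
      using False k(2) pos by (subst ln_le_cancel_iff) (auto simp del: of_nat_mult)
    also have "\<dots> = ln (real (card E)) + ln (real M)"
      using pos by (simp add: ln_mult)
    also have "ln (real M) \<le> K * real d"
      using M(1) pos(2) ln_mono[of "real M" "exp (K * real d)"] by simp
    finally have "ln (real k) / real d \<le> ln (real (card E)) / real d + K"
      using d by (simp add: field_simps)
    then show ?thesis using k E(3) d False pos by (simp add: log_enat_def)
  qed
qed

text \<open>
  The common form of all entropy comparisons: to bound one entropy by another it suffices that every
  pair \<open>(F, \<delta>)\<close> for the second admits a pair \<open>(F', \<delta>')\<close> for the first such that spanning
  numbers grow at most by a factor \<open>exp(K d)\<close>.
\<close>
lemma sofic_h_le_add:
  assumes d: "\<And>i. 1 \<le> d i"
    and step: "\<And>F \<delta>. finite F \<Longrightarrow> F \<noteq> {} \<Longrightarrow> F \<subseteq> carrier G \<Longrightarrow> 0 < \<delta> \<Longrightarrow>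
      \<exists>F' \<delta>'. finite F' \<and> F' \<noteq> {} \<and> F' \<subseteq> carrier G \<and> 0 < \<delta>' \<and>
        (\<forall>i E. finite E \<longrightarrow>
          spanning (sofic_Map X act \<rho> F \<delta> (d i) (\<sigma> i)) (lp_dist p (d i) \<rho>) \<epsilon> E \<longrightarrow>
          (\<exists>M. real M \<le> exp (K * real (d i)) \<and>
            spanning_number (sofic_Map X act \<rho>' F' \<delta>' (d i) (\<sigma> i)) (lp_dist p' (d i) \<rho>') \<epsilon>'
              \<le> enat (card E * M)))"
  shows "sofic_h G X act d \<sigma> p' \<epsilon>' \<rho>' \<le> sofic_h G X act d \<sigma> p \<epsilon> \<rho> + ereal K"
proof -
  let ?S = "\<lambda>\<rho> p \<epsilon> F \<delta> i. log_enat (spanning_number (sofic_Map X act \<rho> F \<delta> (d i) (\<sigma> i))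
              (lp_dist p (d i) \<rho>) \<epsilon>) / ereal (real (d i))"
  have "sofic_h G X act d \<sigma> p' \<epsilon>' \<rho>' - ereal K \<le> sofic_h G X act d \<sigma> p \<epsilon> \<rho>"
    unfolding sofic_h_def [of _ _ _ _ _ p]
  proof (intro INF_greatest)
    fix F and \<delta> :: real
    assume "F \<in> {F. finite F \<and> F \<noteq> {} \<and> F \<subseteq> carrier G}" "\<delta> \<in> {0<..}"
    with step[of F \<delta>] obtain F' \<delta>'
      where F': "F' \<in> {F. finite F \<and> F \<noteq> {} \<and> F \<subseteq> carrier G}" and \<delta>': "\<delta>' \<in> {0<..}"
        and bound: "\<And>i E. finite E \<Longrightarrow>
          spanning (sofic_Map X act \<rho> F \<delta> (d i) (\<sigma> i)) (lp_dist p (d i) \<rho>) \<epsilon> E \<Longrightarrow>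
          \<exists>M. real M \<le> exp (K * real (d i)) \<and>
            spanning_number (sofic_Map X act \<rho>' F' \<delta>' (d i) (\<sigma> i)) (lp_dist p' (d i) \<rho>') \<epsilon>'
              \<le> enat (card E * M)"
      by auto
    have "sofic_h G X act d \<sigma> p' \<epsilon>' \<rho>' \<le> limsup (?S \<rho>' p' \<epsilon>' F' \<delta>')"
      unfolding sofic_h_def by (rule INF_lower2[OF F'], rule INF_lower[OF \<delta>'])
    also have "\<dots> \<le> limsup (\<lambda>i. ?S \<rho> p \<epsilon> F \<delta> i + ereal K)"
      by (intro Limsup_mono always_eventually allI log_spanning_number_le d bound)
    also have "\<dots> = limsup (?S \<rho> p \<epsilon> F \<delta>) + ereal K"
      by (rule Limsup_add_ereal_right) auto
    finally show "sofic_h G X act d \<sigma> p' \<epsilon>' \<rho>' - ereal K \<le> limsup (?S \<rho> p \<epsilon> F \<delta>)"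
      by (simp add: ereal_minus_le)
  qed
  then show ?thesis by (simp add: ereal_minus_le)
qed

lemma lower_mdim_mono:
  assumes d: "\<And>i. 1 \<le> d i" and \<rho>: "pseudometric_on (topspace X) \<rho>"
    and le: "\<And>i \<phi> \<psi>. \<phi> \<in> {1..d i} \<rightarrow> topspace X \<Longrightarrow> \<psi> \<in> {1..d i} \<rightarrow> topspace X \<Longrightarrow>
      lp_dist p (d i) \<rho> \<phi> \<psi> \<le> lp_dist p' (d i) \<rho> \<phi> \<psi>"
  shows "lower_mdim G X act d \<sigma> p \<rho> \<le> lower_mdim G X act d \<sigma> p' \<rho>"
proof -
  have h: "sofic_h G X act d \<sigma> p \<epsilon> \<rho> \<le> sofic_h G X act d \<sigma> p' \<epsilon> \<rho>" for \<epsilon>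
  proof -
    have "sofic_h G X act d \<sigma> p \<epsilon> \<rho> \<le> sofic_h G X act d \<sigma> p' \<epsilon> \<rho> + ereal 0"
    proof (rule sofic_h_le_add[OF d])
      fix F and \<delta> :: real
      assume F: "finite F" "F \<noteq> {}" "F \<subseteq> carrier G" "0 < \<delta>"
      have "spanning_number (sofic_Map X act \<rho> F \<delta> (d i) (\<sigma> i)) (lp_dist p (d i) \<rho>) \<epsilon> \<le> enat (card E * 1)"
        if "finite E" and E: "spanning (sofic_Map X act \<rho> F \<delta> (d i) (\<sigma> i)) (lp_dist p' (d i) \<rho>) \<epsilon> E" for i E
      proof -
        have "sofic_Map X act \<rho> F \<delta> (d i) (\<sigma> i) \<subseteq> {1..d i} \<rightarrow> topspace X"
          by (auto simp: sofic_Map_def)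
        then have "\<phi> \<in> {1..d i} \<rightarrow> topspace X" "\<psi> \<in> {1..d i} \<rightarrow> topspace X"
          if "\<phi> \<in> E" "\<psi> \<in> sofic_Map X act \<rho> F \<delta> (d i) (\<sigma> i)" for \<phi> \<psi>
          using that E unfolding spanning_def by blast+
        then have "lp_dist p (d i) \<rho> \<phi> \<psi> < \<epsilon>"
          if "\<phi> \<in> E" "\<psi> \<in> sofic_Map X act \<rho> F \<delta> (d i) (\<sigma> i)" "lp_dist p' (d i) \<rho> \<phi> \<psi> < \<epsilon>" for \<phi> \<psi>
          using that le[of \<phi> i \<psi>] by (meson order.strict_trans1)
        then have "spanning (sofic_Map X act \<rho> F \<delta> (d i) (\<sigma> i)) (lp_dist p (d i) \<rho>) \<epsilon> E"
          using E unfolding spanning_def by blast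
        with \<open>finite E\<close> show ?thesis by (simp add: spanning_number_le)
      qed
      then show "\<exists>F' \<delta>'. finite F' \<and> F' \<noteq> {} \<and> F' \<subseteq> carrier G \<and> 0 < \<delta>' \<and>
        (\<forall>i E. finite E \<longrightarrow>
          spanning (sofic_Map X act \<rho> F \<delta> (d i) (\<sigma> i)) (lp_dist p' (d i) \<rho>) \<epsilon> E \<longrightarrow>
          (\<exists>M. real M \<le> exp (0 * real (d i)) \<and>
            spanning_number (sofic_Map X act \<rho> F' \<delta>' (d i) (\<sigma> i)) (lp_dist p (d i) \<rho>) \<epsilon>
              \<le> enat (card E * M)))"
        using F by (intro exI[of _ F] exI[of _ \<delta>]) (auto intro!: exI[of _ "1::nat"])
    qed
    then show ?thesis by (simp flip: zero_ereal_def)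
  qed
  show ?thesis
    unfolding lower_mdim_def
  proof (rule Liminf_mono)
    have "\<forall>\<^sub>F \<epsilon> in at_right 0. 0 < ln (1 / \<epsilon> :: real)"
      by real_asymp
    then show "\<forall>\<^sub>F \<epsilon> in at_right 0. sofic_h G X act d \<sigma> p \<epsilon> \<rho> / ereal (ln (1 / \<epsilon>))
        \<le> sofic_h G X act d \<sigma> p' \<epsilon> \<rho> / ereal (ln (1 / \<epsilon>))"
      by eventually_elim (auto intro!: ereal_divide_right_mono h)
  qed
qed

section \<open>From averages to maxima\<close>

text \<open>
  A map \<open>\<phi>\<close> is described up to \<open>\<infinity>\<close>-distance \<open>2r\<close> by an element \<open>e\<close> of \<open>E\<close> that is close
  to it on average, by the set \<open>B\<close> of points where \<open>e\<close> and \<open>\<phi>\<close> are at least \<open>r\<close> apart, and by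
  the codes of \<open>\<phi>\<close> on \<open>B\<close>. Markov's inequality limits the size of \<open>B\<close>.
\<close>
lemma spanning_number_infinity_le:
  assumes d: "1 \<le> d" and \<rho>: "pseudometric_on S \<rho>" and Y: "Y \<subseteq> {1..d} \<rightarrow> S"
    and E: "finite E" "spanning Y (lp_dist 1 d \<rho>) \<epsilon> E"
    and C: "finite C" "\<kappa> ` S \<subseteq> C" and "0 < r"
    and code: "\<And>x y. x \<in> S \<Longrightarrow> y \<in> S \<Longrightarrow> \<kappa> x = \<kappa> y \<Longrightarrow> \<rho> x y < 2 * r"
  shows "spanning_number Y (lp_dist \<infinity> d \<rho>) (2 * r)
    \<le> enat (card E * (\<Sum>B | B \<subseteq> {1..d} \<and> real (card B) * r \<le> real d * \<epsilon>. card C ^ card B))"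
proof -
  let ?B = "{B. B \<subseteq> {1..d} \<and> real (card B) * r \<le> real d * \<epsilon>}"
  let ?I = "E \<times> (SIGMA B:?B. B \<rightarrow>\<^sub>E C)"
  define U where "U = (\<lambda>(e, B, c). {\<phi>. (\<forall>v\<in>{1..d} - B. \<rho> (e v) (\<phi> v) < r) \<and> (\<forall>v\<in>B. \<kappa> (\<phi> v) = c v)})"
  have fB: "finite ?B" by (rule finite_subset[of _ "Pow {1..d}"]) auto
  have finB: "finite B" if "B \<in> ?B" for B
    using that finite_subset[of B "{1..d}"] by auto
  have finI: "finite (SIGMA B:?B. B \<rightarrow>\<^sub>E C)"
    by (intro finite_SigmaI fB finite_PiE finB C)
  have EY: "E \<subseteq> Y" using E(2) by (simp add: spanning_def)
  have "spanning_number Y (lp_dist \<infinity> d \<rho>) (2 * r) \<le> enat (card ?I)"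
  proof (rule spanning_number_le_card_cover)
    show "finite ?I" using E(1) finI by simp
  next
    fix \<phi> assume "\<phi> \<in> Y"
    then obtain e where e: "e \<in> E" "lp_dist 1 d \<rho> e \<phi> < \<epsilon>"
      using E(2) by (auto simp: spanning_def)
    have S: "\<phi> v \<in> S" "e v \<in> S" if "v \<in> {1..d}" for v
      using that Y EY \<open>\<phi> \<in> Y\<close> e(1) by (blast dest: subsetD PiE)+
    then have nn: "\<forall>v\<in>{1..d}. 0 \<le> \<rho> (e v) (\<phi> v)"
      using pseudometric_on_nonneg[OF \<rho>] by blast
    define B where "B = {v \<in> {1..d}. r \<le> \<rho> (e v) (\<phi> v)}"
    have "real (card B) * r \<le> (\<Sum>v\<in>B. \<rho> (e v) (\<phi> v))"
      by (rule sum_bounded_below) (simp add: B_def)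
    also have "\<dots> \<le> (\<Sum>v=1..d. \<rho> (e v) (\<phi> v))"
      by (rule sum_mono2) (use nn in \<open>auto simp: B_def\<close>)
    also have "\<dots> = real d * lp_dist 1 d \<rho> e \<phi>"
      using d nn by (simp add: lp_dist_one)
    also have "\<dots> \<le> real d * \<epsilon>"
      using e(2) by (intro mult_left_mono) auto
    finally have "B \<in> ?B" by (auto simp: B_def)
    moreover have "(\<lambda>v\<in>B. \<kappa> (\<phi> v)) \<in> B \<rightarrow>\<^sub>E C"
      using C(2) S by (auto simp: B_def)
    ultimately have "(e, B, \<lambda>v\<in>B. \<kappa> (\<phi> v)) \<in> ?I"
      using e(1) by simp
    moreover have "\<phi> \<in> U (e, B, \<lambda>v\<in>B. \<kappa> (\<phi> v))"
      by (auto simp: U_def B_def)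
    ultimately show "\<exists>j\<in>?I. \<phi> \<in> U j" by blast
  next
    fix j \<phi> \<psi> assume "j \<in> ?I" and Y': "\<phi> \<in> Y" "\<psi> \<in> Y" and U: "\<phi> \<in> U j" "\<psi> \<in> U j"
    then obtain e B c where j: "j = (e, B, c)" "e \<in> E" by auto
    show "lp_dist \<infinity> d \<rho> \<phi> \<psi> < 2 * r"
      unfolding lp_dist_infinity_less_iff[OF d]
    proof
      fix v assume v: "v \<in> {1..d}"
      then have S: "\<phi> v \<in> S" "\<psi> v \<in> S" "e v \<in> S"
        using Y Y' EY j(2) by (blast dest: subsetD PiE)+
      show "\<rho> (\<phi> v) (\<psi> v) < 2 * r"
      proof (cases "v \<in> B")
        case True
        then show ?thesis using U by (intro code S) (auto simp: U_def j)
      next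
        case False
        then have "\<rho> (e v) (\<phi> v) < r" "\<rho> (e v) (\<psi> v) < r"
          using U v by (auto simp: U_def j)
        then show ?thesis
          using pseudometric_on_triangle[OF \<rho> S(1,3,2)] pseudometric_on_commute[OF \<rho> S(1,3)]
          by linarith
      qed
    qed
  qed
  also have "card ?I = card E * (\<Sum>B\<in>?B. card (B \<rightarrow>\<^sub>E C))"
    unfolding card_cartesian_product
    by (subst card_SigmaI[OF fB]) (intro ballI finite_PiE finB C, assumption, rule refl)
  also have "(\<Sum>B\<in>?B. card (B \<rightarrow>\<^sub>E C)) = (\<Sum>B\<in>?B. card C ^ card B)"
  proof (rule sum.cong[OF refl])
    fix B assume "B \<in> ?B"
    then have "finite B" by (rule finB)
    then show "card (B \<rightarrow>\<^sub>E C) = card C ^ card B" by (simp add: card_PiE)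
  qed
  finally show ?thesis .
qed

text \<open>
  The previous lemma with \<open>r = \<epsilon> L\<^sup>2\<close>, \<open>L = ln(1/\<epsilon>)\<close> and codes of depth \<open>N\<close> about \<open>2L\<close>. The
  depth makes the diameter of a code class less than \<open>2\<epsilon>\<close> since \<open>2\<^sup>-\<^sup>2\<^sup>L < exp(-L)\<close>. An exceptional set has at
  most \<open>d/L\<^sup>2\<close> points, each with at most \<open>N(N + 1) \<le> 12 L\<^sup>2\<close> bits of code, which together with
  \<open>2\<^sup>d\<close> exceptional sets gives the factor \<open>2\<^sup>1\<^sup>3\<^sup>d\<close>.
\<close>
lemma sofic_h_infinity_le_one:
  fixes f :: "nat \<Rightarrow> 'a \<Rightarrow> real"
  assumes f: "\<And>n. continuous_map X (top_of_set {0..1}) (f n)"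
    and d: "\<And>i. 1 \<le> d i" and "0 < \<epsilon>" and L: "1 \<le> ln (1 / \<epsilon>)"
  shows "sofic_h G X act d \<sigma> \<infinity> (2 * (\<epsilon> * (ln (1 / \<epsilon>))\<^sup>2)) (hilbert_metric f)
    \<le> sofic_h G X act d \<sigma> 1 \<epsilon> (hilbert_metric f) + ereal (13 * ln 2)"
proof -
  define L where "L = ln (1 / \<epsilon>)"
  define N where "N = nat \<lceil>2 * L\<rceil>"
  have L1: "1 \<le> L" using L by (simp add: L_def)
  have N: "2 * L \<le> real N" "real N \<le> 3 * L" "real N + 1 \<le> 4 * L"
    using L1 unfolding N_def by linarith+
  have \<epsilon>: "\<epsilon> = exp (- L)"
    using \<open>0 < \<epsilon>\<close> by (simp add: L_def ln_div)
  have "(1 / 2) ^ N = exp (- (real N * ln 2))"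
    by (simp only: exp_minus exp_of_nat_mult) (simp add: power_one_over inverse_eq_divide)
  also have "\<dots> < exp (- L)"
  proof -
    have "2 * L * (2 / 3) \<le> real N * ln 2"
      using N(1) L1 ln2_ge_two_thirds by (intro mult_mono) auto
    then show ?thesis using L1 by simp
  qed
  finally have halfN: "(1 / 2) ^ N < \<epsilon>" by (simp add: \<epsilon>)
  have "1 \<le> L\<^sup>2" using L1 by (simp add: one_le_power)
  then have \<epsilon>L: "\<epsilon> \<le> \<epsilon> * L\<^sup>2" using \<open>0 < \<epsilon>\<close> by simp
  obtain \<kappa> :: "'a \<Rightarrow> nat \<Rightarrow> nat" and C
    where C: "finite C" "card C \<le> 2 ^ (N * (N + 1))" "\<kappa> ` topspace X \<subseteq> C"
      and code: "\<And>x y. x \<in> topspace X \<Longrightarrow> y \<in> topspace X \<Longrightarrow> \<kappa> x = \<kappa> y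
        \<Longrightarrow> hilbert_metric f x y \<le> 2 * (1 / 2) ^ N"
    by (rule hilbert_metric_finite_code[where f = f and N = N, OF f]) (rule that; (assumption | blast))
  have p: "pseudometric_on (topspace X) (hilbert_metric f)"
    using continuous_pseudometric_hilbert_metric[OF f] by (simp add: continuous_pseudometric_def)
  have count: "real (\<Sum>B | B \<subseteq> {1..n} \<and> real (card B) * (\<epsilon> * L\<^sup>2) \<le> real n * \<epsilon>. card C ^ card B)
      \<le> exp (13 * ln 2 * real n)" for n
  proof -
    let ?B = "{B. B \<subseteq> {1..n} \<and> real (card B) * (\<epsilon> * L\<^sup>2) \<le> real n * \<epsilon>}"
    have "card C ^ card B \<le> 2 ^ (12 * n)" if "B \<in> ?B" for B
    proof -
      have "real (card B) * L\<^sup>2 \<le> real n"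
        using that \<open>0 < \<epsilon>\<close> by simp
      then have "12 * (real (card B) * L\<^sup>2) \<le> 12 * real n" by simp
      moreover have "real N * (real N + 1) \<le> 3 * L * (4 * L)"
        using N L1 by (intro mult_mono) auto
      then have "real N * (real N + 1) * real (card B) \<le> 3 * L * (4 * L) * real (card B)"
        by (intro mult_right_mono) auto
      ultimately have "real N * (real N + 1) * real (card B) \<le> 12 * real n"
        by (simp add: power2_eq_square mult_ac)
      then have "real (N * (N + 1) * card B) \<le> real (12 * n)"
        by (simp only: of_nat_mult of_nat_add of_nat_1 of_nat_numeral)
      then have *: "N * (N + 1) * card B \<le> 12 * n" by (simp only: of_nat_le_iff)
      have "card C ^ card B \<le> (2 ^ (N * (N + 1))) ^ card B"
        using C(2) by (intro power_mono) auto
      also have "\<dots> = 2 ^ (N * (N + 1) * card B)" by (simp only: power_mult)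
      also have "\<dots> \<le> 2 ^ (12 * n)" using * by (intro power_increasing) auto
      finally show ?thesis .
    qed
    then have "(\<Sum>B\<in>?B. card C ^ card B) \<le> card ?B * 2 ^ (12 * n)"
      using sum_bounded_above[of ?B "\<lambda>B. card C ^ card B" "2 ^ (12 * n)"] by simp
    also have "card ?B \<le> card (Pow {1..n})"
      by (intro card_mono) auto
    then have "card ?B * 2 ^ (12 * n) \<le> 2 ^ n * 2 ^ (12 * n)"
      by (simp add: card_Pow)
    also have "(2::nat) ^ n * 2 ^ (12 * n) = 2 ^ (13 * n)"
      by (simp flip: power_add)
    finally have "real (\<Sum>B\<in>?B. card C ^ card B) \<le> real (2 ^ (13 * n))"
      by (simp only: of_nat_le_iff)
    also have "\<dots> = exp (13 * ln 2 * real n)"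
    proof -
      have "exp (13 * ln 2 * real n) = exp (real (13 * n) * ln 2 :: real)" by (simp add: mult_ac)
      then show ?thesis by (simp only: exp_of_nat_mult) simp
    qed
    finally show ?thesis .
  qed
  show ?thesis
    unfolding L_def[symmetric]
  proof (rule sofic_h_le_add[OF d], goal_cases)
    case (1 F \<delta>)
    show ?case
    proof (intro exI[of _ F] exI[of _ \<delta>] conjI 1 allI impI exI)
      fix i E
      let ?Y = "sofic_Map X act (hilbert_metric f) F \<delta> (d i) (\<sigma> i)"
      assume E: "finite E" "spanning ?Y (lp_dist 1 (d i) (hilbert_metric f)) \<epsilon> E"
      show "spanning_number ?Y (lp_dist \<infinity> (d i) (hilbert_metric f)) (2 * (\<epsilon> * L\<^sup>2))
        \<le> enat (card E * (\<Sum>B | B \<subseteq> {1..d i} \<and> real (card B) * (\<epsilon> * L\<^sup>2) \<le> real (d i) * \<epsilon>.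
            card C ^ card B))"
      proof (rule spanning_number_infinity_le[OF d p _ E C(1,3)])
        show "?Y \<subseteq> {1..d i} \<rightarrow> topspace X" by (auto simp: sofic_Map_def)
        show "0 < \<epsilon> * L\<^sup>2" using \<open>0 < \<epsilon>\<close> \<epsilon>L by linarith
        show "hilbert_metric f x y < 2 * (\<epsilon> * L\<^sup>2)"
          if "x \<in> topspace X" "y \<in> topspace X" "\<kappa> x = \<kappa> y" for x y
          using code[OF that] halfN \<epsilon>L by linarith
      qed
    qed (rule count)
  qed
qed

lemma lower_mdim_infinity_le_one:
  assumes "\<And>n. continuous_map X (top_of_set {0..1}) (f n)" and "\<And>i. 1 \<le> d i"
  shows "lower_mdim G X act d \<sigma> \<infinity> (hilbert_metric f) \<le> lower_mdim G X act d \<sigma> 1 (hilbert_metric f)"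
  unfolding lower_mdim_def
proof (rule Liminf_growth_rate_rescale[OF rescale_log_squared(1,2)])
  show "\<forall>\<^sub>F \<epsilon> in at_right 0.
      sofic_h G X act d \<sigma> \<infinity> (2 * (\<epsilon> * (ln (1 / \<epsilon>))\<^sup>2)) (hilbert_metric f)
      \<le> sofic_h G X act d \<sigma> 1 \<epsilon> (hilbert_metric f) + ereal (13 * ln 2)"
    using rescale_log_squared(3) eventually_at_right_less[of 0]
    by eventually_elim (rule sofic_h_infinity_le_one[OF assms])
qed

section \<open>From a dynamically generating pseudometric to a Hilbert-cube metric\<close>

text \<open>
  A pseudometric that vanishes only where \<open>\<rho>\<close> does controls approximate equivariance with respect to
  \<open>\<rho>\<close>. The important point is that \<open>\<delta>'\<close> depends neither on the finite set nor on \<open>d\<close> and the maps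
  into the symmetric group: it comes from a pointwise inequality on \<open>X\<close>.
\<close>
lemma sofic_Map_subset_of_finer:
  assumes X: "compact_space X"
    and \<rho>: "continuous_pseudometric X \<rho>" and \<rho>': "continuous_pseudometric X \<rho>'"
    and pos: "\<And>x y. x \<in> topspace X \<Longrightarrow> y \<in> topspace X \<Longrightarrow> 0 < \<rho> x y \<Longrightarrow> 0 < \<rho>' x y"
    and "0 < \<delta>"
  obtains \<delta>' where "0 < \<delta>'"
    "\<And>F d \<sigma>. 1 \<le> d \<Longrightarrow> (\<And>s. s \<in> F \<Longrightarrow> \<sigma> s permutes {1..d}) \<Longrightarrow>
       (\<And>s x. s \<in> F \<Longrightarrow> x \<in> topspace X \<Longrightarrow> act s x \<in> topspace X) \<Longrightarrow>
       sofic_Map X act \<rho>' F \<delta>' d \<sigma> \<subseteq> sofic_Map X act \<rho> F \<delta> d \<sigma>"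
proof -
  obtain C where "0 \<le> C" and dom:
    "\<And>x y. x \<in> topspace X \<Longrightarrow> y \<in> topspace X \<Longrightarrow> (\<rho> x y)\<^sup>2 \<le> \<delta>\<^sup>2 / 2 + C * (\<rho>' x y)\<^sup>2"
    by (rule continuous_pseudometric_square_dominated[OF X \<rho> \<rho>' pos, of "\<delta>\<^sup>2 / 2"])
      (use \<open>0 < \<delta>\<close> in auto)
  \<comment> \<open>chosen so that \<open>C \<delta>'\<^sup>2 < \<delta>\<^sup>2 / 2\<close>; adding 1 avoids division by 0 when \<open>C = 0\<close>\<close>
  define \<delta>' where "\<delta>' = \<delta> / sqrt (2 * (C + 1))"
  have "0 < \<delta>'" using \<open>0 \<le> C\<close> \<open>0 < \<delta>\<close> by (simp add: \<delta>'_def)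
  have "\<delta>'\<^sup>2 = \<delta>\<^sup>2 / (2 * (C + 1))"
    using \<open>0 \<le> C\<close> by (simp add: \<delta>'_def power_divide)
  then have "C * \<delta>'\<^sup>2 + \<delta>'\<^sup>2 = \<delta>\<^sup>2 / 2"
    using \<open>0 \<le> C\<close> by (simp add: field_simps)
  moreover have "0 < \<delta>'\<^sup>2" using \<open>0 < \<delta>'\<close> by simp
  ultimately have C\<delta>: "C * \<delta>'\<^sup>2 < \<delta>\<^sup>2 / 2" by linarith
  have p: "pseudometric_on (topspace X) \<rho>" and p': "pseudometric_on (topspace X) \<rho>'"
    using \<rho> \<rho>' by (auto simp: continuous_pseudometric_def)
  show thesis
  proof
    show "0 < \<delta>'" by fact
    fix F and d :: nat and \<sigma>
    assume d: "1 \<le> d" and \<sigma>: "\<And>s. s \<in> F \<Longrightarrow> \<sigma> s permutes {1..d}"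
      and act: "\<And>s x. s \<in> F \<Longrightarrow> x \<in> topspace X \<Longrightarrow> act s x \<in> topspace X"
    show "sofic_Map X act \<rho>' F \<delta>' d \<sigma> \<subseteq> sofic_Map X act \<rho> F \<delta> d \<sigma>"
    proof
      fix \<phi> assume "\<phi> \<in> sofic_Map X act \<rho>' F \<delta>' d \<sigma>"
      then have \<phi>: "\<phi> \<in> {1..d} \<rightarrow>\<^sub>E topspace X"
        and small: "\<And>s. s \<in> F \<Longrightarrow> lp_dist 2 d \<rho>' (\<phi> \<circ> \<sigma> s) (\<lambda>v. act s (\<phi> v)) < \<delta>'"
        by (auto simp: sofic_Map_def)
      have "lp_dist 2 d \<rho> (\<phi> \<circ> \<sigma> s) (\<lambda>v. act s (\<phi> v)) < \<delta>" if s: "s \<in> F" for s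
      proof -
        define x y where "x = \<phi> \<circ> \<sigma> s" and "y = (\<lambda>v. act s (\<phi> v))"
        have xy: "x v \<in> topspace X" "y v \<in> topspace X" if "v \<in> {1..d}" for v
        proof -
          have "\<sigma> s v \<in> {1..d}" using \<sigma>[OF s] that by (simp only: permutes_in_image)
          with \<phi> that act[OF s] show "x v \<in> topspace X" "y v \<in> topspace X"
            unfolding x_def y_def comp_apply by blast+
        qed
        have nn: "\<forall>v\<in>{1..d}. 0 \<le> \<rho> (x v) (y v)" and nn': "\<forall>v\<in>{1..d}. 0 \<le> \<rho>' (x v) (y v)"
          using xy pseudometric_on_nonneg[OF p] pseudometric_on_nonneg[OF p'] by blast+
        have "sqrt ((\<Sum>v=1..d. (\<rho>' (x v) (y v))\<^sup>2) / real d) < sqrt (\<delta>'\<^sup>2)"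
          using small[OF s, folded x_def y_def] \<open>0 < \<delta>'\<close> unfolding lp_dist_two[where \<rho> = \<rho>' and \<phi> = x and \<psi> = y, OF nn'] by simp
        then have "(\<Sum>v=1..d. (\<rho>' (x v) (y v))\<^sup>2) / real d < \<delta>'\<^sup>2"
          by (rule real_sqrt_less_iff[THEN iffD1])
        then have avg: "(\<Sum>v=1..d. (\<rho>' (x v) (y v))\<^sup>2) < \<delta>'\<^sup>2 * real d"
          using d by (simp add: divide_less_eq)
        have "(\<Sum>v=1..d. (\<rho> (x v) (y v))\<^sup>2) \<le> (\<Sum>v=1..d. \<delta>\<^sup>2 / 2 + C * (\<rho>' (x v) (y v))\<^sup>2)"
          by (intro sum_mono dom xy)
        also have "\<dots> = real d * (\<delta>\<^sup>2 / 2) + C * (\<Sum>v=1..d. (\<rho>' (x v) (y v))\<^sup>2)"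
          by (simp add: sum.distrib sum_distrib_left)
        also have "\<dots> \<le> real d * (\<delta>\<^sup>2 / 2) + C * (\<delta>'\<^sup>2 * real d)"
          using avg \<open>0 \<le> C\<close> by (intro add_left_mono mult_left_mono) auto
        also have "\<dots> = real d * (\<delta>\<^sup>2 / 2 + C * \<delta>'\<^sup>2)" by (simp add: algebra_simps)
        also have "\<dots> < real d * \<delta>\<^sup>2" using C\<delta> d by (intro mult_strict_left_mono) auto
        finally have "(\<Sum>v=1..d. (\<rho> (x v) (y v))\<^sup>2) / real d < \<delta>\<^sup>2"
          using d by (simp add: divide_less_eq mult.commute)
        then have "sqrt ((\<Sum>v=1..d. (\<rho> (x v) (y v))\<^sup>2) / real d) < sqrt (\<delta>\<^sup>2)"
          by (rule real_sqrt_less_mono)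
        then have "lp_dist 2 d \<rho> x y < \<delta>"
          using \<open>0 < \<delta>\<close> unfolding lp_dist_two[where \<rho> = \<rho> and \<phi> = x and \<psi> = y, OF nn] by simp
        then show ?thesis by (simp add: x_def y_def)
      qed
      with \<phi> show "\<phi> \<in> sofic_Map X act \<rho> F \<delta> d \<sigma>" by (simp add: sofic_Map_def)
    qed
  qed
qed

text \<open>
  Approximate equivariance replaces \<open>s\<phi>\<close> and \<open>s\<psi>\<close> by \<open>\<phi> \<circ> \<sigma>\<^sub>s\<close> and \<open>\<psi> \<circ> \<sigma>\<^sub>s\<close> at the
  price of \<open>\<delta>\<close> each, and the permutation \<open>\<sigma>\<^sub>s\<close> does not affect the average. For the maximum
  in place of the average the first step would fail.
\<close>
lemma sofic_Map_translate_dist_le: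
  assumes \<rho>: "pseudometric_on (topspace X) \<rho>" and d: "1 \<le> d" and s: "s \<in> F"
    and \<sigma>: "\<sigma> s permutes {1..d}"
    and act: "\<And>x. x \<in> topspace X \<Longrightarrow> act s x \<in> topspace X"
    and Map: "\<phi> \<in> sofic_Map X act \<rho> F \<delta> d \<sigma>" "\<psi> \<in> sofic_Map X act \<rho> F \<delta> d \<sigma>"
  shows "lp_dist 1 d \<rho> (\<lambda>v. act s (\<phi> v)) (\<lambda>v. act s (\<psi> v)) \<le> lp_dist 1 d \<rho> \<phi> \<psi> + 2 * \<delta>"
proof -
  let ?M = "{1..d} \<rightarrow> topspace X"
  have perm: "\<phi>' \<circ> \<sigma> s \<in> ?M" "(\<lambda>v. act s (\<phi>' v)) \<in> ?M" if "\<phi>' \<in> ?M" for \<phi>'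
  proof -
    have "\<phi>' (\<sigma> s v) \<in> topspace X" if "v \<in> {1..d}" for v
      using \<open>\<phi>' \<in> ?M\<close> permutes_in_image[OF \<sigma>, of v] that by (simp add: Pi_iff)
    then show "\<phi>' \<circ> \<sigma> s \<in> ?M" by simp
    show "(\<lambda>v. act s (\<phi>' v)) \<in> ?M" using that act by (simp add: Pi_iff)
  qed
  have M: "\<phi> \<in> ?M" "\<psi> \<in> ?M" using Map by (auto simp: sofic_Map_def)
  note M' = perm[OF M(1)] perm[OF M(2)]
  have nn: "\<forall>v\<in>{1..d}. 0 \<le> \<rho> (a v) (b v)" if "a \<in> ?M" "b \<in> ?M" for a b
    using that pseudometric_on_nonneg[OF \<rho>] by (simp add: Pi_iff)
  have close: "lp_dist 1 d \<rho> (\<phi>' \<circ> \<sigma> s) (\<lambda>v. act s (\<phi>' v)) < \<delta>"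
    if "\<phi>' \<in> sofic_Map X act \<rho> F \<delta> d \<sigma>" for \<phi>'
  proof -
    have "\<phi>' \<in> ?M" using that by (auto simp: sofic_Map_def)
    from nn[OF perm[OF this]]
    have "lp_dist 1 d \<rho> (\<phi>' \<circ> \<sigma> s) (\<lambda>v. act s (\<phi>' v)) \<le> lp_dist 2 d \<rho> (\<phi>' \<circ> \<sigma> s) (\<lambda>v. act s (\<phi>' v))"
      by (rule lp_dist_one_le) (use d in auto)
    also have "\<dots> < \<delta>" using that s by (simp add: sofic_Map_def)
    finally show ?thesis .
  qed
  have "lp_dist 1 d \<rho> (\<lambda>v. act s (\<phi> v)) (\<lambda>v. act s (\<psi> v))
      \<le> lp_dist 1 d \<rho> (\<lambda>v. act s (\<phi> v)) (\<phi> \<circ> \<sigma> s) + lp_dist 1 d \<rho> (\<phi> \<circ> \<sigma> s) (\<lambda>v. act s (\<psi> v))"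
    by (rule lp_dist_one_triangle[OF \<rho>]; fact)
  also have "lp_dist 1 d \<rho> (\<phi> \<circ> \<sigma> s) (\<lambda>v. act s (\<psi> v))
      \<le> lp_dist 1 d \<rho> (\<phi> \<circ> \<sigma> s) (\<psi> \<circ> \<sigma> s) + lp_dist 1 d \<rho> (\<psi> \<circ> \<sigma> s) (\<lambda>v. act s (\<psi> v))"
    by (rule lp_dist_one_triangle[OF \<rho>]; fact)
  also have "lp_dist 1 d \<rho> (\<phi> \<circ> \<sigma> s) (\<psi> \<circ> \<sigma> s) = lp_dist 1 d \<rho> \<phi> \<psi>"
    by (rule lp_dist_one_permute[where \<rho> = \<rho> and \<phi> = \<phi> and \<psi> = \<psi>, OF nn[OF M] \<sigma>])
  also have "lp_dist 1 d \<rho> (\<lambda>v. act s (\<phi> v)) (\<phi> \<circ> \<sigma> s) = lp_dist 1 d \<rho> (\<phi> \<circ> \<sigma> s) (\<lambda>v. act s (\<phi> v))"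
    by (rule lp_dist_one_commute[OF \<rho>]; fact)
  finally show ?thesis using close[OF Map(1)] close[OF Map(2)] by linarith
qed

text \<open>
  If \<open>\<rho>(gx, gy) > 0\<close>, then a point \<open>w\<close> of a dense set near \<open>gy\<close> has different distances from \<open>gx\<close>
  and \<open>gy\<close>, also after truncation at 1. For empty \<open>X\<close> the points \<open>z n\<close> cannot be chosen in \<open>X\<close>,
  but then continuity and separation are vacuous.
\<close>
lemma translated_distance_functions_separate:
  fixes G :: "('g, 'b) monoid_scheme" and act :: "'g \<Rightarrow> 'a \<Rightarrow> 'a"
  assumes X: "compact_space X" and \<rho>: "continuous_pseudometric X \<rho>"
    and gen: "dynamically_generating G X act \<rho>"
    and G: "countable (carrier G)" "carrier G \<noteq> {}"
    and act: "\<And>s. s \<in> carrier G \<Longrightarrow> continuous_map X X (act s)"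
  obtains s :: "nat \<Rightarrow> 'g" and z :: "nat \<Rightarrow> 'a"
  where "\<And>n. s n \<in> carrier G"
    and "topspace X \<noteq> {} \<Longrightarrow> (\<And>n. z n \<in> topspace X)"
    and "\<And>n. continuous_map X (top_of_set {0..1}) (\<lambda>x. min 1 (\<rho> (act (s n) x) (z n)))"
    and "\<And>x y. x \<in> topspace X \<Longrightarrow> y \<in> topspace X \<Longrightarrow> x \<noteq> y \<Longrightarrow>
      \<exists>n. min 1 (\<rho> (act (s n) x) (z n)) \<noteq> min 1 (\<rho> (act (s n) y) (z n))"
proof (cases "topspace X = {}")
  case True
  obtain g where "g \<in> carrier G" using G(2) by blast
  then show ?thesis
    by (intro that[of "\<lambda>_. g" "\<lambda>_. undefined"]) (use True in auto)
next
  case False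
  have p: "pseudometric_on (topspace X) \<rho>"
    using \<rho> by (simp add: continuous_pseudometric_def)
  obtain Z where Z: "countable Z" "Z \<subseteq> topspace X"
    and dense: "\<And>x \<epsilon>. x \<in> topspace X \<Longrightarrow> 0 < \<epsilon> \<Longrightarrow> \<exists>z\<in>Z. \<rho> x z < \<epsilon>"
    using continuous_pseudometric_separable[OF X \<rho>] by blast
  define sz where "sz = from_nat_into (carrier G \<times> Z)"
  obtain x0 where "x0 \<in> topspace X" using False by blast
  then have "Z \<noteq> {}" using dense[of x0 1] by auto
  then have ne: "carrier G \<times> Z \<noteq> {}" and count: "countable (carrier G \<times> Z)"
    using G Z by auto
  then have sz: "sz n \<in> carrier G \<times> Z" for n
    unfolding sz_def by (intro from_nat_into)
  have s: "fst (sz n) \<in> carrier G" and z: "snd (sz n) \<in> topspace X" for n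
    using sz[of n] Z(2) by auto
  have in_X: "act g x \<in> topspace X" if "g \<in> carrier G" "x \<in> topspace X" for g x
    using act[OF that(1)] that(2) by (simp add: continuous_map_def Pi_iff)
  show ?thesis
  proof (rule that[of "fst \<circ> sz" "snd \<circ> sz"], unfold comp_apply)
    show "fst (sz n) \<in> carrier G" "snd (sz n) \<in> topspace X" for n
      by (fact s z)+
    show "continuous_map X (top_of_set {0..1}) (\<lambda>x. min 1 (\<rho> (act (fst (sz n)) x) (snd (sz n))))" for n
    proof -
      have "continuous_map X (prod_topology X X) (\<lambda>x. (act (fst (sz n)) x, snd (sz n)))"
        using z s act by (intro continuous_map_pairedI) auto
      from continuous_map_compose[OF this, of euclideanreal "\<lambda>(x, y). \<rho> x y"] \<rho>
      have "continuous_map X euclideanreal (\<lambda>x. \<rho> (act (fst (sz n)) x) (snd (sz n)))"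
        by (simp add: continuous_pseudometric_def o_def)
      then have "continuous_map X euclideanreal (\<lambda>x. min 1 (\<rho> (act (fst (sz n)) x) (snd (sz n))))"
        by (intro continuous_map_real_min) auto
      then show ?thesis
        using pseudometric_on_nonneg[OF p in_X[OF s] z] by (simp add: continuous_map_in_subtopology)
    qed
    fix x y assume x: "x \<in> topspace X" and y: "y \<in> topspace X" and "x \<noteq> y"
    then obtain g where g: "g \<in> carrier G" "0 < \<rho> (act g x) (act g y)"
      using gen by (auto simp: dynamically_generating_def)
    note gx = in_X[OF g(1) x] and gy = in_X[OF g(1) y]
    \<comment> \<open>half the truncated distance, so that truncation at 1 keeps the two values apart\<close>
    define r where "r = min 1 (\<rho> (act g x) (act g y)) / 2"
    have "0 < r" using g by (simp add: r_def)
    obtain w where w: "w \<in> Z" "\<rho> (act g y) w < r"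
      using dense[OF gy \<open>0 < r\<close>] by blast
    then have wX: "w \<in> topspace X" using Z by blast
    have "\<rho> (act g x) (act g y) \<le> \<rho> (act g x) w + \<rho> (act g y) w"
      using pseudometric_on_triangle[OF p gx wX gy] pseudometric_on_commute[OF p wX gy] by simp
    then have "min 1 (\<rho> (act g y) w) < min 1 (\<rho> (act g x) w)"
      using w(2) g(2) by (simp add: r_def min_def split: if_splits)
    moreover obtain n where "sz n = (g, w)"
      using from_nat_into_surj[OF count, of "(g, w)"] g(1) w(1) by (auto simp: sz_def)
    ultimately show "\<exists>n. min 1 (\<rho> (act (fst (sz n)) x) (snd (sz n)))
        \<noteq> min 1 (\<rho> (act (fst (sz n)) y) (snd (sz n)))"
      by (metis fst_conv snd_conv less_irrefl)
  qed
qed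

lemma lp_dist_one_hilbert_metric_le:
  assumes f: "\<And>n. continuous_map X (top_of_set {0..1}) (f n)" and d: "1 \<le> d" and "0 \<le> c"
    and in_X: "\<phi> \<in> {1..d} \<rightarrow> topspace X" "\<psi> \<in> {1..d} \<rightarrow> topspace X"
    and bound: "\<And>n. n < N \<Longrightarrow> (\<Sum>v=1..d. \<bar>f n (\<phi> v) - f n (\<psi> v)\<bar>) / real d \<le> c"
  shows "lp_dist 1 d (hilbert_metric f) \<phi> \<psi> \<le> c + (1 / 2) ^ N"
proof -
  let ?a = "\<lambda>n v. \<bar>f n (\<phi> v) - f n (\<psi> v)\<bar>"
  have p: "pseudometric_on (topspace X) (hilbert_metric f)"
    using continuous_pseudometric_hilbert_metric[OF f] by (simp add: continuous_pseudometric_def)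
  have X: "\<phi> v \<in> topspace X" "\<psi> v \<in> topspace X" if "v \<in> {1..d}" for v
    using in_X that by (auto simp: Pi_iff)
  have "(\<Sum>v=1..d. hilbert_metric f (\<phi> v) (\<psi> v))
      \<le> (\<Sum>v=1..d. (\<Sum>n<N. (1 / 2) ^ Suc n * ?a n v) + (1 / 2) ^ N)"
    by (intro sum_mono hilbert_metric_le[OF f] X)
  also have "\<dots> = (\<Sum>v=1..d. \<Sum>n<N. (1 / 2) ^ Suc n * ?a n v) + real d * (1 / 2) ^ N"
    by (simp add: sum.distrib)
  also have "(\<Sum>v=1..d. \<Sum>n<N. (1 / 2) ^ Suc n * ?a n v) = (\<Sum>n<N. (1 / 2) ^ Suc n * (\<Sum>v=1..d. ?a n v))"
    by (subst sum.swap) (simp only: sum_distrib_left)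
  also have "\<dots> \<le> (\<Sum>n<N. (1 / 2) ^ Suc n * (real d * c))"
  proof (intro sum_mono mult_left_mono)
    fix n assume "n \<in> {..<N}"
    then have "(\<Sum>v=1..d. ?a n v) / real d \<le> c" by (intro bound) simp
    then show "(\<Sum>v=1..d. ?a n v) \<le> real d * c"
      using d by (simp add: divide_le_eq mult.commute)
  qed simp
  also have "\<dots> = (1 - (1 / 2) ^ N) * (real d * c)"
    by (simp only: sum_distrib_right[symmetric] sum_half_powers)
  also have "\<dots> \<le> 1 * (real d * c)"
    using \<open>0 \<le> c\<close> by (intro mult_right_mono) auto
  finally have "(\<Sum>v=1..d. hilbert_metric f (\<phi> v) (\<psi> v)) \<le> real d * (c + (1 / 2) ^ N)"
    by (simp add: algebra_simps)
  then have "(\<Sum>v=1..d. hilbert_metric f (\<phi> v) (\<psi> v)) / real d \<le> c + (1 / 2) ^ N"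
    using d by (simp add: divide_le_eq mult.commute)
  moreover have "\<forall>v\<in>{1..d}. 0 \<le> hilbert_metric f (\<phi> v) (\<psi> v)"
    using pseudometric_on_nonneg[OF p] X by blast
  ultimately show ?thesis
    by (simp only: lp_dist_one)
qed

text \<open>
  The scale \<open>5\<epsilon>\<close> is made up of \<open>2\<epsilon>\<close> for two maps near the same element of a spanning set,
  \<open>2\<epsilon>\<close> for replacing \<open>s\<^sub>n\<phi>\<close> and \<open>s\<^sub>n\<psi>\<close> by permuted maps, and \<open>\<epsilon>\<close> for the coordinates
  \<open>n \<ge> N\<close>. Only finitely many \<open>s\<^sub>n\<close> are needed at a given scale, and they are added to the finite set
  \<open>F\<close>.
\<close>
lemma sofic_h_translated_hilbert_metric_le:
  fixes G :: "('g, 'b) monoid_scheme" and act :: "'g \<Rightarrow> 'a \<Rightarrow> 'a" and z :: "nat \<Rightarrow> 'a"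
  assumes X: "compact_space X" and \<rho>: "continuous_pseudometric X \<rho>"
    and act: "\<And>g x. g \<in> carrier G \<Longrightarrow> x \<in> topspace X \<Longrightarrow> act g x \<in> topspace X"
    and d: "\<And>i. 1 \<le> d i"
    and \<sigma>: "\<And>i g. g \<in> carrier G \<Longrightarrow> \<sigma> i g permutes {1..d i}"
    and s: "\<And>n. s n \<in> carrier G"
    and z: "topspace X \<noteq> {} \<Longrightarrow> (\<And>n. z n \<in> topspace X)"
    and f_def: "f = (\<lambda>n x. min 1 (\<rho> (act (s n) x) (z n)))"
    and f: "\<And>n. continuous_map X (top_of_set {0..1}) (f n)"
    and sep: "\<And>x y. x \<in> topspace X \<Longrightarrow> y \<in> topspace X \<Longrightarrow> x \<noteq> y \<Longrightarrow> \<exists>n. f n x \<noteq> f n y"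
    and "0 < \<epsilon>"
  shows "sofic_h G X act d \<sigma> 1 (5 * \<epsilon>) (hilbert_metric f) \<le> sofic_h G X act d \<sigma> 1 \<epsilon> \<rho> + ereal 0"
proof (rule sofic_h_le_add[OF d], goal_cases)
  case (1 F \<delta>)
  have p: "pseudometric_on (topspace X) \<rho>"
    using \<rho> by (simp add: continuous_pseudometric_def)
  have c': "continuous_pseudometric X (hilbert_metric f)"
    by (rule continuous_pseudometric_hilbert_metric[OF f])
  have lipschitz: "\<bar>f n x - f n y\<bar> \<le> \<rho> (act (s n) x) (act (s n) y)"
    if "x \<in> topspace X" "y \<in> topspace X" for n x y
  proof -
    have a: "act (s n) x \<in> topspace X" "act (s n) y \<in> topspace X"
      using that act s by blast+
    moreover have "z n \<in> topspace X" using z that by blast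
    ultimately have "\<bar>\<rho> (act (s n) x) (z n) - \<rho> (act (s n) y) (z n)\<bar> \<le> \<rho> (act (s n) x) (act (s n) y)"
      using pseudometric_on_triangle[OF p, of "act (s n) x" "act (s n) y" "z n"]
        pseudometric_on_triangle[OF p, of "act (s n) y" "act (s n) x" "z n"]
        pseudometric_on_commute[OF p a]
      by simp
    then show ?thesis unfolding f_def by linarith
  qed
  have "\<forall>\<^sub>F N in sequentially. (1 / 2 :: real) ^ N < \<epsilon>"
    by (rule order_tendstoD[OF LIMSEQ_power_zero]) (use \<open>0 < \<epsilon>\<close> in auto)
  then obtain N where N: "(1 / 2 :: real) ^ N < \<epsilon>"
    using eventually_happens'[OF sequentially_bot] by blast
  define F1 where "F1 = F \<union> s ` {..<N}"
  define \<delta>1 where "\<delta>1 = min \<delta> \<epsilon>"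
  have F1: "finite F1" "F1 \<noteq> {}" "F1 \<subseteq> carrier G" using 1 s by (auto simp: F1_def)
  have "0 < \<delta>1" using 1 \<open>0 < \<epsilon>\<close> by (simp add: \<delta>1_def)
  have finer: "0 < hilbert_metric f x y"
    if "x \<in> topspace X" "y \<in> topspace X" "0 < \<rho> x y" for x y
  proof -
    have "x \<noteq> y" using that pseudometric_on_self[OF p] by auto
    then obtain n where "f n x \<noteq> f n y" using sep \<open>x \<in> topspace X\<close> \<open>y \<in> topspace X\<close> by blast
    with that show ?thesis by (intro hilbert_metric_pos[OF f])
  qed
  obtain \<delta>' where "0 < \<delta>'"
    and subset: "\<And>i. sofic_Map X act (hilbert_metric f) F1 \<delta>' (d i) (\<sigma> i)
      \<subseteq> sofic_Map X act \<rho> F1 \<delta>1 (d i) (\<sigma> i)"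
  proof (rule sofic_Map_subset_of_finer[OF X \<rho> c' _ \<open>0 < \<delta>1\<close>, where act = act], goal_cases)
    case (1 x y)
    then show ?case by (intro finer)
  next
    case (2 \<delta>')
    show ?case
      by (rule that[OF 2(2)], rule 2(3)[OF d]) (use \<sigma> act F1(3) in blast)+
  qed
  show ?case
  proof (intro exI[of _ F1] exI[of _ \<delta>'] conjI F1 \<open>0 < \<delta>'\<close> allI impI exI[of _ "1 :: nat"])
    fix i E
    let ?Y = "sofic_Map X act \<rho> F \<delta> (d i) (\<sigma> i)"
    let ?Y1 = "sofic_Map X act \<rho> F1 \<delta>1 (d i) (\<sigma> i)"
    let ?Y' = "sofic_Map X act (hilbert_metric f) F1 \<delta>' (d i) (\<sigma> i)"
    let ?M = "{1..d i} \<rightarrow> topspace X"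
    assume E: "finite E" "spanning ?Y (lp_dist 1 (d i) \<rho>) \<epsilon> E"
    have Y'1: "?Y' \<subseteq> ?Y1" by (rule subset)
    have Y1: "?Y1 \<subseteq> ?Y"
      by (auto simp: sofic_Map_def F1_def \<delta>1_def)
    have YM: "?Y \<subseteq> ?M" by (auto simp: sofic_Map_def)
    have EM: "E \<subseteq> ?M" using E(2) YM by (auto simp: spanning_def)
    have close: "lp_dist 1 (d i) (hilbert_metric f) \<phi> \<psi> < 5 * \<epsilon>"
      if \<phi>: "\<phi> \<in> ?Y1" and \<psi>: "\<psi> \<in> ?Y1" and e: "e \<in> E"
        and near: "lp_dist 1 (d i) \<rho> e \<phi> < \<epsilon>" "lp_dist 1 (d i) \<rho> e \<psi> < \<epsilon>" for \<phi> \<psi> e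
    proof -
      have M: "\<phi> \<in> ?M" "\<psi> \<in> ?M" "e \<in> ?M" using \<phi> \<psi> e Y1 YM EM by blast+
      have dist: "lp_dist 1 (d i) \<rho> \<phi> \<psi> < 2 * \<epsilon>"
        using lp_dist_one_triangle[OF p M(1,3,2)] lp_dist_one_commute[OF p M(1,3)] near by linarith
      have "lp_dist 1 (d i) (hilbert_metric f) \<phi> \<psi> \<le> 4 * \<epsilon> + (1 / 2) ^ N"
      proof (rule lp_dist_one_hilbert_metric_le[OF f d _ M(1,2)])
        fix n assume "n < N"
        then have sF: "s n \<in> F1" by (simp add: F1_def)
        have "(\<Sum>v=1..d i. \<bar>f n (\<phi> v) - f n (\<psi> v)\<bar>)
            \<le> (\<Sum>v=1..d i. \<rho> (act (s n) (\<phi> v)) (act (s n) (\<psi> v)))"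
          by (intro sum_mono lipschitz) (use M in \<open>auto simp: Pi_iff\<close>)
        moreover have nn: "\<forall>v\<in>{1..d i}. 0 \<le> \<rho> (act (s n) (\<phi> v)) (act (s n) (\<psi> v))"
          using M s by (intro ballI pseudometric_on_nonneg[OF p] act) (auto simp: Pi_iff)
        ultimately have "(\<Sum>v=1..d i. \<bar>f n (\<phi> v) - f n (\<psi> v)\<bar>) / real (d i)
            \<le> lp_dist 1 (d i) \<rho> (\<lambda>v. act (s n) (\<phi> v)) (\<lambda>v. act (s n) (\<psi> v))"
          by (simp only: lp_dist_one divide_right_mono of_nat_0_le_iff)
        also have "\<dots> \<le> lp_dist 1 (d i) \<rho> \<phi> \<psi> + 2 * \<delta>1"
          by (rule sofic_Map_translate_dist_le[OF p d sF \<sigma>[OF s] act[OF s] \<phi> \<psi>])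
        also have "\<dots> \<le> 4 * \<epsilon>" using dist by (simp add: \<delta>1_def)
        finally show "(\<Sum>v=1..d i. \<bar>f n (\<phi> v) - f n (\<psi> v)\<bar>) / real (d i) \<le> 4 * \<epsilon>" .
      qed (use \<open>0 < \<epsilon>\<close> in simp)
      with N show ?thesis by linarith
    qed
    have "spanning_number ?Y' (lp_dist 1 (d i) (hilbert_metric f)) (5 * \<epsilon>) \<le> enat (card E)"
    proof (rule spanning_number_le_card_cover[where U = "\<lambda>e. {\<phi>. lp_dist 1 (d i) \<rho> e \<phi> < \<epsilon>}", OF E(1)])
      show "\<exists>e\<in>E. \<phi> \<in> {\<phi>. lp_dist 1 (d i) \<rho> e \<phi> < \<epsilon>}" if "\<phi> \<in> ?Y'" for \<phi>
        using E(2) that Y'1 Y1 unfolding spanning_def by blast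
      show "lp_dist 1 (d i) (hilbert_metric f) \<phi> \<psi> < 5 * \<epsilon>"
        if "e \<in> E" "\<phi> \<in> ?Y'" "\<psi> \<in> ?Y'" "\<phi> \<in> {\<phi>. lp_dist 1 (d i) \<rho> e \<phi> < \<epsilon>}"
          "\<psi> \<in> {\<phi>. lp_dist 1 (d i) \<rho> e \<phi> < \<epsilon>}" for e \<phi> \<psi>
        using close[of \<phi> \<psi> e] that Y'1 by blast
    qed
    then show "spanning_number ?Y' (lp_dist 1 (d i) (hilbert_metric f)) (5 * \<epsilon>) \<le> enat (card E * 1)"
      by simp
  qed simp
qed

section \<open>Equality of the infima\<close>

theorem theorem5p2:
  fixes G :: "('g, 'b) monoid_scheme"
    and X :: "'a topology"
    and act :: "'g \<Rightarrow> 'a \<Rightarrow> 'a"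
    and d :: "nat \<Rightarrow> nat"
    and \<sigma> :: "nat \<Rightarrow> 'g \<Rightarrow> nat \<Rightarrow> nat"
    and q :: ereal
  assumes "sofic_group G"
    and "compact_space X" and "metrizable_space X"
    and "group_action G (topspace X) act"
    and "\<forall>g\<in>carrier G. homeomorphic_map X X (act g)"
    and "sofic_approximation G d \<sigma>"
    and "1 \<le> q"
  shows "sofic_D G X act d \<sigma> =
           (INF \<rho>\<in>hilbert_cube_metrics X. lower_mdim G X act d \<sigma> q \<rho>)"
proof -
  let ?D = "mdim_M G X act d \<sigma>"
  let ?H = "\<lambda>p. INF \<rho>\<in>hilbert_cube_metrics X. lower_mdim G X act d \<sigma> p \<rho>"
  let ?gen = "{\<rho>. continuous_pseudometric X \<rho> \<and> dynamically_generating G X act \<rho>}"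
  have G: "group G" "countable (carrier G)"
    using assms(1) by (auto simp: sofic_group_def)
  then have one: "\<one>\<^bsub>G\<^esub> \<in> carrier G" by (simp add: group.is_monoid)
  interpret A: group_action G "topspace X" act by fact
  have act_cont: "continuous_map X X (act g)" if "g \<in> carrier G" for g
    using assms(5) that homeomorphic_imp_continuous_map by blast
  have act: "act g x \<in> topspace X" if "g \<in> carrier G" "x \<in> topspace X" for g x
    using A.element_image that by blast
  have act_one: "act \<one>\<^bsub>G\<^esub> x = x" if "x \<in> topspace X" for x
    using that by (simp flip: A.id_eq_one)
  have d: "1 \<le> d i" for i
    using assms(6) by (simp add: sofic_approximation_def)
  have \<sigma>: "\<sigma> i g permutes {1..d i}" if "g \<in> carrier G" for i g
  proof -
    have "\<sigma> i g \<in> carrier (sym_group (d i))"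
      using assms(6) that unfolding sofic_approximation_def by blast
    then show ?thesis by (simp only: sym_group_carrier)
  qed

  have hilbert_gen: "hilbert_cube_metrics X \<subseteq> ?gen"
  proof
    fix \<rho> assume "\<rho> \<in> hilbert_cube_metrics X"
    then obtain f where f: "\<And>n. continuous_map X (top_of_set {0..1}) (f n)"
      and sep: "\<And>x y. x \<in> topspace X \<Longrightarrow> y \<in> topspace X \<Longrightarrow> x \<noteq> y \<Longrightarrow> \<exists>n. f n x \<noteq> f n y"
      and \<rho>: "\<rho> = hilbert_metric f"
      unfolding hilbert_cube_metrics_eq by blast
    have "0 < \<rho> (act \<one>\<^bsub>G\<^esub> x) (act \<one>\<^bsub>G\<^esub> y)"
      if "x \<in> topspace X" "y \<in> topspace X" "x \<noteq> y" for x y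
      using sep[OF that] that hilbert_metric_pos[OF f] by (auto simp: \<rho> act_one)
    then have "dynamically_generating G X act \<rho>"
      unfolding dynamically_generating_def using one by blast
    with continuous_pseudometric_hilbert_metric[OF f] show "\<rho> \<in> ?gen"
      by (simp add: \<rho>)
  qed

  have mono: "lower_mdim G X act d \<sigma> 1 \<rho> \<le> lower_mdim G X act d \<sigma> p \<rho>"
      "lower_mdim G X act d \<sigma> p \<rho> \<le> lower_mdim G X act d \<sigma> \<infinity> \<rho>"
    if "\<rho> \<in> ?gen" "1 \<le> p" for p \<rho>
  proof -
    have ps: "pseudometric_on (topspace X) \<rho>"
      using that by (simp add: continuous_pseudometric_def)
    have nn: "\<forall>v\<in>{1..d i}. 0 \<le> \<rho> (\<phi> v) (\<psi> v)"
      if "\<phi> \<in> {1..d i} \<rightarrow> topspace X" "\<psi> \<in> {1..d i} \<rightarrow> topspace X" for i \<phi> \<psi>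
      using that pseudometric_on_nonneg[OF ps] by (simp add: Pi_iff)
    show "lower_mdim G X act d \<sigma> 1 \<rho> \<le> lower_mdim G X act d \<sigma> p \<rho>"
      by (intro lower_mdim_mono d ps lp_dist_one_le nn \<open>1 \<le> p\<close>)
    show "lower_mdim G X act d \<sigma> p \<rho> \<le> lower_mdim G X act d \<sigma> \<infinity> \<rho>"
      by (intro lower_mdim_mono d ps lp_dist_le_infinity nn \<open>1 \<le> p\<close>)
  qed

  have key: "?H \<infinity> \<le> ?D 1"
    unfolding mdim_M_def
  proof (rule INF_greatest)
    fix \<rho> assume "\<rho> \<in> ?gen"
    then have \<rho>: "continuous_pseudometric X \<rho>" "dynamically_generating G X act \<rho>" by auto
    have "carrier G \<noteq> {}" using one by blast
    then show "?H \<infinity> \<le> lower_mdim G X act d \<sigma> 1 \<rho>"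
    proof (rule translated_distance_functions_separate[OF assms(2) \<rho> G(2)])
      show "continuous_map X X (act g)" if "g \<in> carrier G" for g by (rule act_cont[OF that])
    next
      fix s and z :: "nat \<Rightarrow> 'a"
      assume s: "\<And>n. s n \<in> carrier G"
        and z: "topspace X \<noteq> {} \<Longrightarrow> (\<And>n. z n \<in> topspace X)"
        and f: "\<And>n. continuous_map X (top_of_set {0..1}) (\<lambda>x. min 1 (\<rho> (act (s n) x) (z n)))"
        and sep: "\<And>x y. x \<in> topspace X \<Longrightarrow> y \<in> topspace X \<Longrightarrow> x \<noteq> y \<Longrightarrow>
          \<exists>n. min 1 (\<rho> (act (s n) x) (z n)) \<noteq> min 1 (\<rho> (act (s n) y) (z n))"
      define f where "f = (\<lambda>n x. min 1 (\<rho> (act (s n) x) (z n)))"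
      have fc: "continuous_map X (top_of_set {0..1}) (f n)" for n using f by (simp add: f_def)
      have fs: "\<exists>n. f n x \<noteq> f n y" if "x \<in> topspace X" "y \<in> topspace X" "x \<noteq> y" for x y
        using sep[OF that] by (simp add: f_def)
      have "?H \<infinity> \<le> lower_mdim G X act d \<sigma> \<infinity> (hilbert_metric f)"
        by (rule INF_lower) (use fc fs in \<open>auto simp: hilbert_cube_metrics_eq\<close>)
      also have "\<dots> \<le> lower_mdim G X act d \<sigma> 1 (hilbert_metric f)"
        by (rule lower_mdim_infinity_le_one[OF fc d])
      also have "\<dots> \<le> lower_mdim G X act d \<sigma> 1 \<rho>"
        unfolding lower_mdim_def
      proof (rule Liminf_growth_rate_rescale[OF rescale_constant])
        show "\<forall>\<^sub>F \<epsilon> in at_right 0. sofic_h G X act d \<sigma> 1 (5 * \<epsilon>) (hilbert_metric f)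
            \<le> sofic_h G X act d \<sigma> 1 \<epsilon> \<rho> + ereal 0"
          using eventually_at_right_less[of 0]
          by eventually_elim
            (rule sofic_h_translated_hilbert_metric_le[OF assms(2) \<rho>(1) act d \<sigma> s z f_def fc fs])
      qed
      finally show "?H \<infinity> \<le> lower_mdim G X act d \<sigma> 1 \<rho>" .
    qed
  qed

  have D: "?D 1 \<le> ?D p" and H: "?H p \<le> ?H \<infinity>" and DH: "?D p \<le> ?H p" if "1 \<le> p" for p
  proof -
    show "?D 1 \<le> ?D p"
      unfolding mdim_M_def
    proof (rule INF_mono)
      fix \<rho> assume "\<rho> \<in> ?gen"
      with mono(1)[OF this that]
      show "\<exists>\<rho>'\<in>?gen. lower_mdim G X act d \<sigma> 1 \<rho>' \<le> lower_mdim G X act d \<sigma> p \<rho>" by blast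
    qed
    show "?H p \<le> ?H \<infinity>"
    proof (rule INF_mono)
      fix \<rho> assume "\<rho> \<in> hilbert_cube_metrics X"
      with mono(2)[OF subsetD[OF hilbert_gen this] that]
      show "\<exists>\<rho>'\<in>hilbert_cube_metrics X. lower_mdim G X act d \<sigma> p \<rho>' \<le> lower_mdim G X act d \<sigma> \<infinity> \<rho>"
        by blast
    qed
    show "?D p \<le> ?H p"
      unfolding mdim_M_def by (rule INF_superset_mono[OF hilbert_gen]) simp
  qed
  have eq: "?D p = ?D 1" "?H p = ?D 1" if "1 \<le> p" for p
  proof -
    have "?H p \<le> ?D 1" using H[OF that] key by (rule order.trans)
    moreover have "?D 1 \<le> ?D p" "?D p \<le> ?H p" by (fact D[OF that], fact DH[OF that])
    ultimately show "?D p = ?D 1" "?H p = ?D 1" by order+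
  qed
  have "sofic_D G X act d \<sigma> = ?D 1"
    unfolding sofic_D_def
  proof (rule the_equality)
    show "\<forall>p\<ge>1. ?D p = ?D 1" using eq(1) by blast
    show "x = ?D 1" if "\<forall>p\<ge>1. ?D p = x" for x using that by simp
  qed
  then show ?thesis using eq(2)[OF assms(7)] by simp
qed

end
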